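(* There is a universal constant $C>0$ (independent of $t$ and of the data) such that the following holds. Let $\mu_0^\ell=(\rho_0^\ell,\rho_0^\ell v_0^\ell)\in\hat{\mathcal V}(\mathbb R)$, $\ell=1,2$, be discrete initial data and let $\mu_t^\ell=(\rho_t^\ell,\rho_t^\ell v_t^\ell)=\mathscr S_t[\mu_0^\ell]$, $t\ge 0$, be the corresponding solutions of the discrete sticky particle system. Then for every convex, even, lower semicontinuous function $\psi:\mathbb R\to[0,+\infty]$, every $p\in[1,+\infty)$ and every $t\ge 0$, $$\mathcal C_\psi(\rho_t^1,\rho_t^2)\le\int_{\mathbb R\times\mathbb R}\psi\big(x+tv_0^1(x)-(y+tv_0^2(y))\big)\,d\boldsymbol\rho(x,y),\qquad \boldsymbol\rho=\Gamma_o(\rho_0^1,\rho_0^2),$$ $$W_p(\rho_t^1,\rho_t^2)\le W_p(\rho_0^1,\rho_0^2)+t\,U_p(\mu_0^1,\mu_0^2),$$ $$\int_0^tU_2^2(\mu_r^1,\mu_r^2)\,dr\le C(1+t)\big([\mu_0^1]_2+[\mu_0^2]_2\big)\big(W_2(\rho_0^1,\rho_0^2)+U_2(\mu_0^1,\mu_0^2)\big).$$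
   Context: Monotone rearrangement: for a Borel probability measure $\rho$ on $\mathbb R$, $X_\rho(w):=\inf\{x:\rho((-\infty,x])>w\}$, $w\in(0,1)$; it is nondecreasing, right-continuous, and $(X_\rho)_\#\lambda=\rho$, where $\lambda$ is Lebesgue measure on $(0,1)$ and $\#$ denotes push-forward. $\Gamma_o(\rho^1,\rho^2):=(X_{\rho^1},X_{\rho^2})_\#\lambda$ is the (monotone) optimal coupling on $\mathbb R\times\mathbb R$. $\mathcal P_p(\mathbb R)$ is the set of Borel probability measures with finite $p$-moment and $W_p$ is the $L^p$-Wasserstein distance on it, so $W_p^p(\rho^1,\rho^2)=\int_0^1|X_{\rho^1}-X_{\rho^2}|^p\,dw$. For a convex, even, lower semicontinuous $\psi:\mathbb R\to[0,+\infty]$, $\mathcal C_\psi(\rho^1,\rho^2):=\inf\int_{\mathbb R\times\mathbb R}\psi(x-y)\,d\boldsymbol\rho(x,y)$, the infimum being over all couplings $\boldsymbol\rho$ of $\rho^1,\rho^2$. $\mathcal M(\mathbb R)$ is the space of signed Borel measures with finite total variation and $\mathcal V_p(\mathbb R):=\{\mu=(\rho,\rho v)\in\mathcal P_p(\mathbb R)\times\mathcal M(\mathbb R): v\in L^p_\rho(\mathbb R)\}$, where $L^p_\rho(\mathbb R)=L^p(\mathbb R,\rho)$. For $\mu^i=(\rho^i,\rho^iv^i)$, $U_p^p(\mu^1,\mu^2):=\int|v^1(x)-v^2(y)|^p\,d\boldsymbol\rho(x,y)$ with $\boldsymbol\rho=\Gamma_o(\rho^1,\rho^2)$, i.e. $\int_0^1|v^1(X_{\rho^1}(w))-v^2(X_{\rho^2}(w))|^p\,dw$;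 and $[\mu]_p^p:=\int_{\mathbb R}(|x|^p+|v(x)|^p)\,d\rho(x)$. $\hat{\mathcal V}(\mathbb R)$ is the set of discrete data $\mu=(\sum_{i=1}^Nm_i\delta_{x_i},\sum_{i=1}^Nm_iv_i\delta_{x_i})$ with $N\in\mathbb N$, $m_i>0$, $\sum_i m_i=1$, $x_i,v_i\in\mathbb R$; one may take $x_1<\dots<x_N$. Discrete sticky particle system: given such $\mu$ with $x_1<\dots<x_N$, the particles have constant masses $m_i$, continuous piecewise linear ordered trajectories $x_1(t)\le\dots\le x_N(t)$, and piecewise constant right-continuous velocities $v_i(t)$ equal to the right derivative of $x_i$, with $x_i(0)=x_i$, $v_i(0)=v_i$. The sets $J_i(t):=\{j:x_j(t)=x_i(t)\}$ are nondecreasing in $t$ (particles stick after collision). There are finitely many collision times $0<t_1<t_2<\cdots$ (times at which some $J_i$ grows); velocities are constant between collision times, and at each collision time $v_i(t_k+)=\sum_{j\in J_i(t_k)}m_jv_j(t_k-)\big/\sum_{j\in J_i(t_k)}m_j$ for all $i$. Then $\mathscr S_t[\mu]:=(\sum_im_i\delta_{x_i(t)},\sum_im_iv_i(t)\delta_{x_i(t)})\in\hat{\mathcal V}(\mathbb R)$. *)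

theory Defs
  imports "HOL-Probability.Probability"
begin

section \<open>One-dimensional optimal transport\<close>

text \<open>Distances are valued in \<open>[0,\<infinity>]\<close>, so that no divergent integral is replaced by a
  default value. \<open>ennpowr\<close> is the power with a positive real exponent.\<close>

definition ennpowr :: "ennreal \<Rightarrow> real \<Rightarrow> ennreal" where
  "ennpowr x a = (if x = \<infinity> then \<infinity> else ennreal (enn2real x powr a))"

definition rearrangement :: "real measure \<Rightarrow> real \<Rightarrow> real" where
  "rearrangement \<rho> w = Inf {x. cdf \<rho> x > w}"

definition optimal_coupling :: "real measure \<Rightarrow> real measure \<Rightarrow> (real \<times> real) measure" where
  "optimal_coupling \<rho>1 \<rho>2 =
     distr (restrict_space lborel {0<..<1}) (borel \<Otimes>\<^sub>M borel)
       (\<lambda>w. (rearrangement \<rho>1 w, rearrangement \<rho>2 w))"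

definition couplings :: "real measure \<Rightarrow> real measure \<Rightarrow> (real \<times> real) measure set" where
  "couplings \<rho>1 \<rho>2 =
     {\<pi>. prob_space \<pi> \<and> sets \<pi> = sets (borel \<Otimes>\<^sub>M borel) \<and>
         distr \<pi> borel fst = \<rho>1 \<and> distr \<pi> borel snd = \<rho>2}"

definition transport_cost :: "(real \<Rightarrow> ennreal) \<Rightarrow> real measure \<Rightarrow> real measure \<Rightarrow> ennreal" where
  "transport_cost \<psi> \<rho>1 \<rho>2 =
     (INF \<pi>\<in>couplings \<rho>1 \<rho>2. \<integral>\<^sup>+ (x, y). \<psi> (x - y) \<partial>\<pi>)"

definition wasserstein :: "real \<Rightarrow> real measure \<Rightarrow> real measure \<Rightarrow> ennreal" where
  "wasserstein p \<rho>1 \<rho>2 =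
     ennpowr (transport_cost (\<lambda>z. ennreal (\<bar>z\<bar> powr p)) \<rho>1 \<rho>2) (1 / p)"

text \<open>\<open>convex_on\<close> only covers functions valued in a real vector space. In \<^typ>\<open>ennreal\<close> the
  convention \<open>0 * \<infinity> = 0\<close> makes the endpoint cases \<open>u = 0\<close> and \<open>u = 1\<close> trivial.\<close>

definition convex_enn :: "(real \<Rightarrow> ennreal) \<Rightarrow> bool" where
  "convex_enn \<psi> \<longleftrightarrow>
     (\<forall>x y. \<forall>u\<in>{0..1}.
        \<psi> ((1 - u) * x + u * y) \<le> ennreal (1 - u) * \<psi> x + ennreal u * \<psi> y)"

definition lower_semicontinuous :: "(real \<Rightarrow> ennreal) \<Rightarrow> bool" where
  "lower_semicontinuous \<psi> \<longleftrightarrow> (\<forall>x. \<psi> x \<le> Liminf (at x) \<psi>)"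


section \<open>Measures with velocity\<close>

text \<open>A pair \<open>(\<rho>, \<eta>)\<close> of a probability measure and a finite signed Borel measure, the latter
  given as a real-valued set function, of which only the values on Borel sets matter.\<close>

type_synonym velocity_measure = "real measure \<times> (real set \<Rightarrow> real)"

text \<open>The density \<open>v\<close> in \<open>\<eta> = \<rho> v\<close>. It is determined only up to \<open>\<rho>\<close>-null sets; all quantities
  below depend only on this equivalence class, since the marginals of the optimal coupling
  are the two given measures.\<close>

definition velocity :: "velocity_measure \<Rightarrow> real \<Rightarrow> real" where
  "velocity \<mu> = (SOME v. v \<in> borel_measurable borel \<and> integrable (fst \<mu>) v \<and>
     (\<forall>A\<in>sets borel. snd \<mu> A = (LINT x:A|fst \<mu>. v x)))"

definition velocity_dist :: "real \<Rightarrow> velocity_measure \<Rightarrow> velocity_measure \<Rightarrow> ennreal" where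
  "velocity_dist p \<mu>1 \<mu>2 =
     ennpowr (\<integral>\<^sup>+ (x, y). ennreal (\<bar>velocity \<mu>1 x - velocity \<mu>2 y\<bar> powr p)
                \<partial>optimal_coupling (fst \<mu>1) (fst \<mu>2)) (1 / p)"

definition moment_norm :: "real \<Rightarrow> velocity_measure \<Rightarrow> ennreal" where
  "moment_norm p \<mu> =
     ennpowr (\<integral>\<^sup>+ x. ennreal (\<bar>x\<bar> powr p + \<bar>velocity \<mu> x\<bar> powr p) \<partial>fst \<mu>) (1 / p)"

text \<open>Particles are indexed by \<open>i < N\<close>. The measure \<open>\<Sum>i<N. m i \<cdot> \<delta>(x i)\<close> is realised as the image
  under \<open>x\<close> of the weighted counting measure on the indices.\<close>

definition discrete_measure :: "nat \<Rightarrow> (nat \<Rightarrow> real) \<Rightarrow> (nat \<Rightarrow> real) \<Rightarrow> real measure" where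
  "discrete_measure N m x = distr (point_measure {..<N} (\<lambda>i. ennreal (m i))) borel x"

definition discrete_datum ::
  "nat \<Rightarrow> (nat \<Rightarrow> real) \<Rightarrow> (nat \<Rightarrow> real) \<Rightarrow> (nat \<Rightarrow> real) \<Rightarrow> velocity_measure" where
  "discrete_datum N m x v =
     (discrete_measure N m x, \<lambda>A. \<Sum>i<N. m i * v i * indicator A (x i))"

definition discrete_data :: "velocity_measure set" where
  "discrete_data =
     {discrete_datum N m x v | N m x v. (\<forall>i<N. 0 < m i) \<and> (\<Sum>i<N. m i) = 1}"


section \<open>The discrete sticky particle system\<close>

definition cluster :: "nat \<Rightarrow> (nat \<Rightarrow> real \<Rightarrow> real) \<Rightarrow> nat \<Rightarrow> real \<Rightarrow> nat set" where
  "cluster N X i t = {j. j < N \<and> X j t = X i t}"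

definition collision_times :: "nat \<Rightarrow> (nat \<Rightarrow> real \<Rightarrow> real) \<Rightarrow> real set" where
  "collision_times N X =
     {t. 0 < t \<and> (\<exists>i<N. \<forall>s. 0 \<le> s \<and> s < t \<longrightarrow> cluster N X i s \<subset> cluster N X i t)}"

text \<open>\<open>X i t\<close> and \<open>V i t\<close> are position and velocity of particle \<open>i\<close> at time \<open>t \<ge> 0\<close>; values at
  negative times are irrelevant. Since \<open>V\<close> is right-continuous, \<open>V i t\<close> is the velocity after
  a collision at time \<open>t\<close>.\<close>

locale sticky_particles =
  fixes N :: nat
    and m x v :: "nat \<Rightarrow> real"
    and X V :: "nat \<Rightarrow> real \<Rightarrow> real"
  assumes mass_pos: "i < N \<Longrightarrow> 0 < m i"
    and mass_sum: "(\<Sum>i<N. m i) = 1"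
    and initial_ordered: "i < j \<Longrightarrow> j < N \<Longrightarrow> x i < x j"
    and initial_position: "i < N \<Longrightarrow> X i 0 = x i"
    and initial_velocity: "i < N \<Longrightarrow> V i 0 = v i"
    and position_continuous: "i < N \<Longrightarrow> continuous_on {0..} (X i)"
    and position_ordered: "i \<le> j \<Longrightarrow> j < N \<Longrightarrow> 0 \<le> t \<Longrightarrow> X i t \<le> X j t"
    and velocity_right_derivative:
      "i < N \<Longrightarrow> 0 \<le> t \<Longrightarrow> (X i has_real_derivative V i t) (at_right t)"
    and sticking:
      "i < N \<Longrightarrow> 0 \<le> s \<Longrightarrow> s \<le> t \<Longrightarrow> cluster N X i s \<subseteq> cluster N X i t"
    and finite_collision_times: "finite (collision_times N X)"
    and velocity_constant:
      "i < N \<Longrightarrow> 0 \<le> s \<Longrightarrow> s \<le> t \<Longrightarrow> collision_times N X \<inter> {s<..t} = {} \<Longrightarrow> V i t = V i s"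
    and position_linear:
      "i < N \<Longrightarrow> 0 \<le> s \<Longrightarrow> s \<le> t \<Longrightarrow> collision_times N X \<inter> {s<..<t} = {} \<Longrightarrow>
         X i t = X i s + (t - s) * V i s"
    and collision:
      "i < N \<Longrightarrow> t \<in> collision_times N X \<Longrightarrow>
         V i t = (\<Sum>j\<in>cluster N X i t. m j * Lim (at_left t) (V j)) / (\<Sum>j\<in>cluster N X i t. m j)"

text \<open>\<open>\<mu> t\<close>, \<open>t \<ge> 0\<close>, is the evolution of the initial datum \<open>\<mu>\<^sub>0\<close> under the sticky particle system.\<close>

definition sticky_evolution :: "velocity_measure \<Rightarrow> (real \<Rightarrow> velocity_measure) \<Rightarrow> bool" where
  "sticky_evolution \<mu>\<^sub>0 \<mu> \<longleftrightarrow>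
     (\<exists>N m x v X V. sticky_particles N m x v X V \<and>
        \<mu>\<^sub>0 = discrete_datum N m x v \<and>
        (\<forall>t\<ge>0. \<mu> t = discrete_datum N m (\<lambda>i. X i t) (\<lambda>i. V i t)))"

end

theory Submission
  imports Defs
begin

text \<open>In terms of the quantile variable the positions of a sticky particle system form a
  nondecreasing profile \<open>X t\<close>, and \<open>X t\<close> is the \<open>L\<^sup>2\<close> projection of the free motion \<open>x + t v\<close> onto
  the cone of nondecreasing profiles. The reason is local in time: at a collision the velocity is
  averaged over the new clusters, and the incoming velocity is nonincreasing inside each of them;
  by Chebyshev's sum inequality the lost velocity is then polar to every profile that is nondecreasing inside
  the clusters (\<open>velocity_loss_polar\<close>). Integration in time gives the same for the displacement
  \<open>x + t v - X t\<close> (\<open>displacement_polar\<close>). All three estimates rest on these two facts.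

  Two systems are compared through the monotone coupling of their masses, a finite
  comonotone matrix on pairs of indices which is the same at all times, since masses and order are
  preserved. A subgradient of a convex function \<open>\<psi>\<close> at the difference \<open>X1 - X2\<close> is monotone along the clusters of either
  system, so polarity of the two displacements shows that passing from the free to the sticky
  motions decreases the integral of \<open>\<psi>\<close> of the difference (\<open>convex_contraction\<close>,
  \<open>convex_enn_contraction\<close>). This is the first estimate. The second one is the case \<open>\<bar>z\<bar>^p\<close> combined with Minkowski's inequality
  and with the optimality of the monotone coupling at time \<open>0\<close> (\<open>comonotone_optimal\<close>).

  For the third estimate write \<open>\<xi> = V(0) - V\<close> for the lost velocity. Each system solves
  \<open>X' = V(0) - \<xi>\<close> with \<open>\<xi>\<close> normal to the cone at \<open>X\<close>, so the dissipation
  \<open>S = - \<langle>\<xi>1, X2\<rangle> - \<langle>\<xi>2, X1\<rangle>\<close> is nonnegative, and its time integral is quadratic in the distance of the positions. The squared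
  distance of the velocities equals \<open>\<langle>V1(0) - V2(0), V1 - V2\<rangle> + \<langle>\<xi>1, V2\<rangle> + \<langle>\<xi>2, V1\<rangle>\<close>. The first term
  integrates to something linear in the distance of the positions. In the other two, \<open>\<xi>\<close> is
  frozen at the beginning of a time interval of length \<open>h\<close>; then \<open>\<langle>\<xi>1(r), V2\<rangle>\<close> integrates to
  \<open>\<langle>\<xi>1(r), X2(r + h) - X2(r)\<rangle>\<close>, and since \<open>\<langle>\<xi>1(r), X2(r + h)\<rangle> \<le> 0\<close>, at most the dissipation
  remains. The error of freezing is controlled because the velocities \<open>V\<close> of each system are successive
  orthogonal projections: \<open>V1(r) - V1(u)\<close> is orthogonal to \<open>V1(u)\<close>, so
  \<open>\<langle>V1(r) - V1(u), V2(u)\<rangle>\<close> is at most a fraction of \<open>\<bar>V1(u) - V2(u)\<bar>^2\<close> plus the drop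
  \<open>\<bar>V1(r)\<bar>^2 - \<bar>V1(u)\<bar>^2\<close> (\<open>frozen_loss_estimate\<close>). Averaging over \<open>r\<close>, with \<open>d\<close> a bound for the distance of the
  positions and \<open>E\<close> for the energy, bounds the time integral by a multiple of
  \<open>\<bar>V1(0) - V2(0)\<bar> d + d^2 / h + h E\<close> (\<open>velocity_gap_bound\<close>), and \<open>h\<close> of order \<open>d / sqrt E\<close> gives the claim.\<close>

section \<open>Averaging over clusters\<close>

text \<open>The classes are the level sets of \<open>k\<close>; for particles, \<open>k\<close> is the position and the classes are
  the clusters.\<close>

definition class_average :: "'i set \<Rightarrow> ('i \<Rightarrow> real) \<Rightarrow> ('i \<Rightarrow> real) \<Rightarrow> ('i \<Rightarrow> real) \<Rightarrow> 'i \<Rightarrow> real" where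
  "class_average I w k a i =
     (\<Sum>j\<in>{j\<in>I. k j = k i}. w j * a j) / (\<Sum>j\<in>{j\<in>I. k j = k i}. w j)"

text \<open>A Chebyshev sum inequality inside each class. With \<open>c i j = w i * w j / w(class of i)\<close> for
  \<open>i, j\<close> in the same class, a symmetric weight, the left-hand side is
  \<open>\<Sum>i j. c i j * (a i - a j) * z i\<close>, and exchanging \<open>i\<close> and \<open>j\<close> turns twice this sum into
  \<open>\<Sum>i j. c i j * (a i - a j) * (z i - z j)\<close>.\<close>

lemma class_average_chebyshev:
  fixes w a z :: "'i \<Rightarrow> real" and k :: "'i \<Rightarrow> real"
  assumes fin: "finite I" and w: "\<And>i. i \<in> I \<Longrightarrow> 0 < w i"
    and opp: "\<And>i j. i \<in> I \<Longrightarrow> j \<in> I \<Longrightarrow> k i = k j \<Longrightarrow> (a i - a j) * (z i - z j) \<le> 0"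
  shows "(\<Sum>i\<in>I. w i * (a i - class_average I w k a i) * z i) \<le> 0"
proof -
  define M where "M i = (\<Sum>j\<in>{j\<in>I. k j = k i}. w j)" for i
  define c where "c i j = (if k j = k i then w i * w j / M i else 0)" for i j
  have Mpos: "0 < M i" if "i \<in> I" for i
    unfolding M_def using that fin w by (intro sum_pos2[of _ i]) (auto intro: less_imp_le)
  have csym: "c i j = c j i" for i j
    by (auto simp: c_def M_def)
  have cnn: "0 \<le> c i j" if "i \<in> I" "j \<in> I" for i j
    using that Mpos[of i] w by (auto simp: c_def intro!: divide_nonneg_pos mult_nonneg_nonneg less_imp_le)
  have row: "w i * (a i - class_average I w k a i) * z i = (\<Sum>j\<in>I. c i j * (a i - a j) * z i)"
    if i: "i \<in> I" for i
  proof -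
    have "(\<Sum>j\<in>I. c i j * (a i - a j) * z i)
        = (\<Sum>j\<in>{j\<in>I. k j = k i}. w i * w j / M i * (a i - a j) * z i)"
      unfolding sum.inter_filter[OF fin] by (intro sum.cong) (auto simp: c_def)
    also have "\<dots> = (\<Sum>j\<in>{j\<in>I. k j = k i}. w i * z i / M i * (w j * a i - w j * a j))"
      by (intro sum.cong) (auto simp: algebra_simps diff_divide_distrib)
    also have "\<dots> = w i * z i / M i * (M i * a i - (\<Sum>j\<in>{j\<in>I. k j = k i}. w j * a j))"
      by (simp only: M_def sum_distrib_left[symmetric] sum_subtractf sum_distrib_right[symmetric])
    also have "\<dots> = w i * (a i - class_average I w k a i) * z i"
      using Mpos[OF i] by (simp add: class_average_def M_def field_simps)
    finally show ?thesis by simp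
  qed
  let ?S = "\<Sum>i\<in>I. \<Sum>j\<in>I. c i j * (a i - a j) * z i"
  have "?S = (\<Sum>i\<in>I. \<Sum>j\<in>I. c j i * (a j - a i) * z j)"
    by (rule sum.swap)
  also have "\<dots> = (\<Sum>i\<in>I. \<Sum>j\<in>I. c i j * (a j - a i) * z j)"
    by (simp add: csym)
  finally have "2 * ?S = ?S + (\<Sum>i\<in>I. \<Sum>j\<in>I. c i j * (a j - a i) * z j)"
    by simp
  also have "\<dots> = (\<Sum>i\<in>I. \<Sum>j\<in>I. c i j * ((a i - a j) * (z i - z j)))"
    by (simp only: sum.distrib[symmetric]) (simp add: algebra_simps)
  also have "\<dots> \<le> 0"
  proof (intro sum_nonpos)
    fix i j assume "i \<in> I" "j \<in> I"
    then show "c i j * ((a i - a j) * (z i - z j)) \<le> 0"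
      using cnn[of i j] opp[of i j] 
      by (cases "k i = k j") (blast intro: mult_nonneg_nonpos, simp add: c_def)
  qed
  finally show ?thesis using row by simp
qed

section \<open>The sticky particle system as a projection\<close>

text \<open>The test profiles against which the losses of the dynamics are measured. They include the
  profiles that are nondecreasing in the index, and, together with their negatives, those that are constant on
  each cluster.\<close>

definition cluster_mono :: "nat \<Rightarrow> (nat \<Rightarrow> real \<Rightarrow> real) \<Rightarrow> real \<Rightarrow> (nat \<Rightarrow> real) \<Rightarrow> bool" where
  "cluster_mono N X t z \<longleftrightarrow> (\<forall>i j. i \<le> j \<longrightarrow> j < N \<longrightarrow> X i t = X j t \<longrightarrow> z i \<le> z j)"

context sticky_particles
begin

lemma clusters_persist:
  assumes "i < N" "j < N" "0 \<le> s" "s \<le> t" "X i s = X j s"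
  shows "X i t = X j t"
  using sticking[of j s t] assms by (auto simp: cluster_def)

lemma cluster_mono_antimono:
  assumes "cluster_mono N X t z" "0 \<le> s" "s \<le> t"
  shows "cluster_mono N X s z"
  using assms clusters_persist unfolding cluster_mono_def by (meson order.strict_trans1)

lemma velocity_eq_in_cluster:
  assumes "i < N" "j < N" "0 \<le> t" "X i t = X j t"
  shows "V i t = V j t"
proof -
  have "X i r = X j r" if "t \<le> r" for r
    using that assms clusters_persist[of i j t r] by auto
  then have "((\<lambda>r. (X j r - X j t) / (r - t)) \<longlongrightarrow> V i t) (at_right t)"
    using velocity_right_derivative[OF assms(1,3)] unfolding has_field_derivative_iff
    by (elim Lim_transform_eventually) (auto simp: eventually_at_filter)
  moreover have "((\<lambda>r. (X j r - X j t) / (r - t)) \<longlongrightarrow> V j t) (at_right t)"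
    using velocity_right_derivative[OF assms(2,3)] unfolding has_field_derivative_iff .
  ultimately show ?thesis
    by (rule tendsto_unique[rotated]) simp
qed

text \<open>At a collision the velocity is replaced by its average over the clusters that have just formed.
  Inside such a cluster the incoming velocity is nonincreasing in the index, because particles
  that were ordered meet; so the lost velocity is opposed to every profile
  that is nondecreasing inside the clusters.\<close>

lemma collision_loss:
  assumes t: "t \<in> collision_times N X" and s: "0 \<le> s" "s < t"
    and free: "collision_times N X \<inter> {s<..<t} = {}"
    and z: "cluster_mono N X t z"
  shows "(\<Sum>i<N. m i * (V i s - V i t) * z i) \<le> 0"
proof -
  have lim: "Lim (at_left t) (V j) = V j s" if j: "j < N" for j
  proof -
    have "V j r = V j s" if "r \<in> {s<..<t}" for r
      using that free s by (intro velocity_constant[OF j]) auto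
    then have "((V j) \<longlongrightarrow> V j s) (at_left t)"
      using s by (intro tendsto_eventually) (auto simp: eventually_at_left[of s] intro!: exI[of _ s])
    then show ?thesis by (intro tendsto_Lim) auto
  qed
  have avg: "V i t = class_average {..<N} m (\<lambda>i. X i t) (\<lambda>i. V i s) i" if i: "i < N" for i
    unfolding collision[OF i t] class_average_def cluster_def
    by (auto simp: lim intro!: arg_cong2[where f="(/)"] sum.cong)
  have move: "X i t = X i s + (t - s) * V i s" if "i < N" for i
    using that s free by (intro position_linear) auto
  have anti: "V j s \<le> V i s" if "i \<le> j" "j < N" "X i t = X j t" for i j
  proof -
    have "(t - s) * V j s \<le> (t - s) * V i s"
      using move[of i] move[of j] position_ordered[of i j s] that s by linarith
    then show ?thesis using s by (simp add: mult_le_cancel_left_pos)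
  qed
  have "(\<Sum>i<N. m i * (V i s - class_average {..<N} m (\<lambda>i. X i t) (\<lambda>i. V i s) i) * z i) \<le> 0"
  proof (rule class_average_chebyshev)
    fix i j assume ij: "i \<in> {..<N}" "j \<in> {..<N}" "X i t = X j t"
    show "(V i s - V j s) * (z i - z j) \<le> 0"
    proof (cases "i \<le> j")
      case True
      then show ?thesis using anti[of i j] z ij
        by (intro mult_nonneg_nonpos) (auto simp: cluster_mono_def)
    next
      case False
      then show ?thesis using anti[of j i] z ij
        by (intro mult_nonpos_nonneg) (auto simp: cluster_mono_def)
    qed
  qed (auto simp: mass_pos)
  then show ?thesis by (simp add: avg)
qed

text \<open>The collision losses add up, since a profile that is monotone inside the clusters at time \<open>t\<close>
  is so inside the smaller clusters at all earlier times.\<close>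

theorem velocity_loss_polar:
  assumes "0 \<le> t" "cluster_mono N X t z"
  shows "(\<Sum>i<N. m i * (v i - V i t) * z i) \<le> 0"
  using assms
proof (induction "card (collision_times N X \<inter> {0<..t})" arbitrary: t rule: less_induct)
  case less
  let ?C = "\<lambda>t. collision_times N X \<inter> {0<..t}"
  have fin: "finite (?C r)" for r using finite_collision_times by auto
  show ?case
  proof (cases "?C t = {}")
    case True
    have "V i t = v i" if "i < N" for i
      using velocity_constant[of i 0 t] that less.prems True by (simp add: initial_velocity)
    then show ?thesis by simp
  next
    case False
    define c where "c = Max (?C t)"
    have c: "c \<in> ?C t" unfolding c_def by (rule Max_in[OF fin False])
    have cmax: "r \<le> c" if "r \<in> ?C t" for r unfolding c_def by (rule Max_ge[OF fin that])
    define B where "B = insert 0 (collision_times N X \<inter> {0<..<c})"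
    define s where "s = Max B"
    have finB: "finite B" unfolding B_def using finite_collision_times by auto
    have sB: "s \<in> B" unfolding s_def by (rule Max_in[OF finB]) (auto simp: B_def)
    have smax: "r \<le> s" if "r \<in> B" for r unfolding s_def by (rule Max_ge[OF finB that])
    have s: "0 \<le> s" "s < c" using sB c by (auto simp: B_def)
    have "?C s \<subset> ?C t"
      using s c by (intro psubsetI) (auto dest: equalityD2[THEN subsetD, of _ _ c])
    then have "card (?C s) < card (?C t)" by (rule psubset_card_mono[OF fin])
    moreover have "cluster_mono N X s z"
      using cluster_mono_antimono[OF less.prems(2)] s c by auto
    ultimately have IH: "(\<Sum>i<N. m i * (v i - V i s) * z i) \<le> 0"
      using less.hyps s by blast
    have jump: "(\<Sum>i<N. m i * (V i s - V i c) * z i) \<le> 0"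
    proof (rule collision_loss)
      show "collision_times N X \<inter> {s<..<c} = {}"
        using smax s unfolding B_def by fastforce
      show "cluster_mono N X c z"
        using cluster_mono_antimono[OF less.prems(2)] c by auto
    qed (use c s in auto)
    have "V i t = V i c" if "i < N" for i
    proof (rule velocity_constant[OF that])
      show "collision_times N X \<inter> {c<..t} = {}"
        using cmax c by fastforce
    qed (use c in auto)
    then have "(\<Sum>i<N. m i * (v i - V i t) * z i)
        = (\<Sum>i<N. m i * (v i - V i s) * z i) + (\<Sum>i<N. m i * (V i s - V i c) * z i)"
      by (simp add: sum.distrib[symmetric] algebra_simps)
    with IH jump show ?thesis by linarith
  qed
qed

lemma position_derivative:
  assumes i: "i < N" and t: "0 < t" "t \<notin> collision_times N X"
  shows "(X i has_real_derivative V i t) (at t)"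
proof -
  let ?C = "collision_times N X"
  have "open (- ?C \<inter> {0<..})"
    using finite_collision_times by (intro open_Int open_Compl finite_imp_closed) auto
  then obtain e where e: "0 < e" "ball t e \<subseteq> - ?C \<inter> {0<..}"
    using t by (meson IntI ComplI greaterThan_iff open_contains_ball_eq)
  define s where "s = t - e / 2"
  have sub: "{t - e<..<t + e} \<subseteq> - ?C \<inter> {0<..}"
    using e(2) by (simp add: ball_eq_greaterThanLessThan)
  have s: "t - e < s" "s < t" "s < t + e" using e(1) by (auto simp: s_def)
  have s0: "0 < s" using subsetD[OF sub, of s] s by auto
  have free: "?C \<inter> {s<..<t + e} = {}"
    using sub s(1) by (fastforce simp: subset_iff)
  have lin: "X i r = X i s + (r - s) * V i s" if "r \<in> {s<..<t + e}" for r
    using that free s0 by (intro position_linear[OF i]) auto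
  have "V i t = V i s"
    using free s s0 e(1) by (intro velocity_constant[OF i]) auto
  moreover have "((\<lambda>r. X i s + (r - s) * V i s) has_real_derivative V i s) (at t)"
    by (auto intro!: derivative_eq_intros)
  then have "(X i has_real_derivative V i s) (at t)"
    by (rule has_field_derivative_transform_within_open[where S="{s<..<t + e}"])
       (use s e(1) lin in auto)
  ultimately show ?thesis by simp
qed

lemma velocity_has_integral:
  assumes "i < N" "0 \<le> a" "a \<le> b"
  shows "(V i has_integral X i b - X i a) {a..b}"
proof (rule fundamental_theorem_of_calculus_interior_strong[OF finite_collision_times assms(3)])
  show "(X i has_vector_derivative V i r) (at r)" if "r \<in> {a<..<b} - collision_times N X" for r
    using that assms position_derivative
    by (simp add: has_real_derivative_iff_has_vector_derivative[symmetric])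
  show "continuous_on {a..b} (X i)"
    using position_continuous[OF assms(1)] by (rule continuous_on_subset) (use assms in auto)
qed

text \<open>Integrating in time: the displacement \<open>x + t v - X t\<close> from the free motion lies in the polar
  cone as well. This says that the positions are the projection of the free
  motion onto the nondecreasing profiles.\<close>

theorem displacement_polar:
  assumes "0 \<le> t" "cluster_mono N X t z"
  shows "(\<Sum>i<N. m i * (x i + t * v i - X i t) * z i) \<le> 0"
proof -
  have "((\<lambda>r. \<Sum>i<N. m i * (v i - V i r) * z i) has_integral
      (\<Sum>i<N. m i * (x i + t * v i - X i t) * z i)) {0..t}"
  proof (intro has_integral_sum)
    fix i assume i: "i \<in> {..<N}"
    have "((\<lambda>r. m i * (v i - V i r) * z i) has_integral m i * (t * v i - (X i t - X i 0)) * z i) {0..t}"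
      using has_integral_const_real[of "v i" 0 t] assms(1) i
      by (intro has_integral_mult_left has_integral_mult_right has_integral_diff velocity_has_integral) auto
    then show "((\<lambda>r. m i * (v i - V i r) * z i) has_integral m i * (x i + t * v i - X i t) * z i) {0..t}"
      using i by (simp add: initial_position algebra_simps)
  qed auto
  then show ?thesis
  proof (rule has_integral_le[OF _ has_integral_0])
    fix r assume "r \<in> {0..t}"
    then show "(\<Sum>i<N. m i * (v i - V i r) * z i) \<le> 0"
      using velocity_loss_polar cluster_mono_antimono[OF assms(2)] by auto
  qed
qed

end

section \<open>Comonotone couplings of two finite systems of masses\<close>

text \<open>The coupling matrix is given by its support \<open>P\<close> and its positive entries \<open>g\<close>. The last
  assumption says that \<open>P\<close> is a chain in the product order.\<close>

locale comonotone_coupling =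
  fixes N1 N2 :: nat and m1 m2 :: "nat \<Rightarrow> real"
    and P :: "(nat \<times> nat) set" and g :: "nat \<times> nat \<Rightarrow> real"
  assumes support: "P \<subseteq> {..<N1} \<times> {..<N2}"
    and weight_pos: "p \<in> P \<Longrightarrow> 0 < g p"
    and fst_marginal: "i < N1 \<Longrightarrow> (\<Sum>p\<in>{p\<in>P. fst p = i}. g p) = m1 i"
    and snd_marginal: "j < N2 \<Longrightarrow> (\<Sum>p\<in>{p\<in>P. snd p = j}. g p) = m2 j"
    and comonotone: "p \<in> P \<Longrightarrow> q \<in> P \<Longrightarrow> fst p < fst q \<Longrightarrow> snd p \<le> snd q"
begin

lemma finite_support: "finite P"
  using support by (rule finite_subset) auto

lemma comonotone_snd: "p \<in> P \<Longrightarrow> q \<in> P \<Longrightarrow> snd p < snd q \<Longrightarrow> fst p \<le> fst q"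
  using comonotone[of q p] by fastforce

lemma fst_less: "p \<in> P \<Longrightarrow> fst p < N1" and snd_less: "p \<in> P \<Longrightarrow> snd p < N2"
  using support by auto

end

lemma sum_fibres:
  fixes g :: "'p \<Rightarrow> real" and N :: nat
  assumes "finite P" "k ` P \<subseteq> {..<N}" "\<And>i. i < N \<Longrightarrow> (\<Sum>p\<in>{p\<in>P. k p = i}. g p) = m i"
  shows "(\<Sum>p\<in>P. g p * f (k p)) = (\<Sum>i<N. m i * f i)"
proof -
  have "(\<Sum>p\<in>P. g p * f (k p)) = (\<Sum>i<N. \<Sum>p\<in>{p\<in>P. k p = i}. g p * f (k p))"
    by (rule sum.group[symmetric]) (use assms(1,2) in auto)
  also have "\<dots> = (\<Sum>i<N. (\<Sum>p\<in>{p\<in>P. k p = i}. g p) * f i)"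
    unfolding sum_distrib_right by (intro sum.cong) auto
  finally show ?thesis using assms(3) by simp
qed

text \<open>A polar vector of particle indices stays polar on the pairs of a coupling: only the average
  \<open>zbar i\<close> of a profile \<open>z\<close> over the pairs belonging to \<open>i\<close> is seen, and averaging over the fibres
  preserves monotonicity.\<close>

lemma polar_lift:
  fixes g :: "'p \<Rightarrow> real"
  assumes P: "finite P" "k ` P \<subseteq> {..<N}" and g: "\<And>p. p \<in> P \<Longrightarrow> 0 < g p"
    and marg: "\<And>i. i < N \<Longrightarrow> (\<Sum>p\<in>{p\<in>P. k p = i}. g p) = m i"
    and m: "\<And>i. i < N \<Longrightarrow> 0 < m i"
    and polar: "\<And>z. cluster_mono N X t z \<Longrightarrow> (\<Sum>i<N. m i * h i * z i) \<le> 0"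
    and z: "\<And>p q. p \<in> P \<Longrightarrow> q \<in> P \<Longrightarrow> k p < k q \<Longrightarrow> X (k p) t = X (k q) t \<Longrightarrow> z p \<le> z q"
  shows "(\<Sum>p\<in>P. g p * h (k p) * z p) \<le> 0"
proof -
  define F where "F i = {p\<in>P. k p = i}" for i
  define zbar where "zbar i = (\<Sum>p\<in>F i. g p * z p) / m i" for i
  have finF: "finite (F i)" for i using P(1) by (simp add: F_def)
  have m_eq: "(\<Sum>p\<in>F i. g p) = m i" if "i < N" for i using marg[OF that] by (simp add: F_def)
  have gF: "0 < g p" if "p \<in> F i" for p i using that g by (auto simp: F_def)
  have mono: "zbar i \<le> zbar j" if ij: "i \<le> j" "j < N" "X i t = X j t" for i j
  proof (cases "i = j")
    case False
    have iN: "i < N" using ij by simp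
    have ne: "F i \<noteq> {}" using m_eq[OF iN] m[OF iN] by auto
    define c where "c = Max (z ` F i)"
    have c_ge: "z p \<le> c" if "p \<in> F i" for p
      using that finF unfolding c_def by (intro Max_ge) auto
    have "c \<in> z ` F i" unfolding c_def using ne finF by (intro Max_in) auto
    then have c_le: "c \<le> z q" if "q \<in> F j" for q
      using that z False ij by (fastforce simp: F_def)
    have "(\<Sum>p\<in>F i. g p * z p) \<le> (\<Sum>p\<in>F i. g p * c)"
      using c_ge gF by (intro sum_mono mult_left_mono) (auto intro: less_imp_le)
    then have "(\<Sum>p\<in>F i. g p * z p) \<le> c * m i"
      by (simp add: sum_distrib_left[symmetric] m_eq[OF iN] mult.commute[of _ c])
    then have 1: "zbar i \<le> c" using m[OF iN] by (simp add: zbar_def pos_divide_le_eq)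
    have "(\<Sum>p\<in>F j. g p * c) \<le> (\<Sum>p\<in>F j. g p * z p)"
      using c_le gF by (intro sum_mono mult_left_mono) (auto intro: less_imp_le)
    then have "c * m j \<le> (\<Sum>p\<in>F j. g p * z p)"
      by (simp add: sum_distrib_left[symmetric] m_eq[OF ij(2)] mult.commute[of _ c])
    then have 2: "c \<le> zbar j" using m[OF ij(2)] by (simp add: zbar_def pos_le_divide_eq)
    from 1 2 show ?thesis by simp
  qed simp
  have "(\<Sum>p\<in>P. g p * h (k p) * z p) = (\<Sum>i<N. \<Sum>p\<in>F i. g p * h (k p) * z p)"
    unfolding F_def by (rule sum.group[symmetric]) (use P in auto)
  also have "\<dots> = (\<Sum>i<N. h i * (\<Sum>p\<in>F i. g p * z p))"
    unfolding sum_distrib_left by (intro sum.cong) (auto simp: F_def)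
  also have "\<dots> = (\<Sum>i<N. m i * h i * zbar i)"
    using m by (intro sum.cong) (force simp: zbar_def)+
  also have "\<dots> \<le> 0"
    by (rule polar) (use mono in \<open>auto simp: cluster_mono_def\<close>)
  finally show ?thesis .
qed

text \<open>A Monge cost decreases when masses are uncrossed. After summation by parts in both indices
  the cost of a matrix \<open>a\<close> with given marginals is a constant plus the sum of the
  mixed second differences \<open>\<le> 0\<close> of the cost weighted with the distribution function of \<open>a\<close>. The
  latter is at most the smaller of the two marginal distribution functions, with equality when \<open>a\<close>
  is comonotone.\<close>

lemma telescope_from:
  fixes f :: "nat \<Rightarrow> real"
  assumes "i \<le> n"
  shows "f i = f n + (\<Sum>k<n. if i \<le> k then f k - f (Suc k) else 0)"
  using assms
proof (induction n)
  case (Suc n)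
  show ?case
  proof (cases "i = Suc n")
    case True
    then have "(\<Sum>k<Suc n. if i \<le> k then f k - f (Suc k) else 0) = 0"
      by (intro sum.neutral) auto
    with True show ?thesis by simp
  qed (use Suc in auto)
qed simp

lemma cost_by_parts:
  fixes a c :: "nat \<Rightarrow> nat \<Rightarrow> real"
  defines "A \<equiv> \<lambda>k l. \<Sum>i\<le>k. \<Sum>j\<le>l. a i j"
    and "D \<equiv> \<lambda>k l. c k l + c (Suc k) (Suc l) - c (Suc k) l - c k (Suc l)"
  assumes row: "\<And>i. i \<le> n \<Longrightarrow> (\<Sum>j\<le>n'. a i j) = r i"
    and col: "\<And>j. j \<le> n' \<Longrightarrow> (\<Sum>i\<le>n. a i j) = s j"
  shows "(\<Sum>i\<le>n. \<Sum>j\<le>n'. a i j * c i j) =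
    (\<Sum>i\<le>n. r i * c i n') + (\<Sum>j\<le>n'. s j * c n j) - (\<Sum>i\<le>n. r i) * c n n'
      + (\<Sum>k<n. \<Sum>l<n'. D k l * A k l)"
proof -
  define e where "e i k = (if i \<le> k then 1 else 0 :: real)" for i k :: nat
  have c_eq: "c i j = c i n' + c n j - c n n' + (\<Sum>k<n. \<Sum>l<n'. e i k * e j l * D k l)"
    if "i \<le> n" "j \<le> n'" for i j
  proof -
    have D_eq: "(c i l - c n l) - (c i (Suc l) - c n (Suc l)) = (\<Sum>k<n. e i k * D k l)" for l
      using telescope_from[OF that(1), of "\<lambda>i. c i l - c i (Suc l)"]
      by (simp add: e_def D_def if_distrib if_distribR algebra_simps cong: if_cong)
    have "c i j - c n j = (c i n' - c n n') + (\<Sum>l<n'. e j l * (\<Sum>k<n. e i k * D k l))"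
      using telescope_from[OF that(2), of "\<lambda>j. c i j - c n j"]
      by (simp add: e_def[of j] D_eq if_distrib if_distribR cong: if_cong)
    also have "(\<Sum>l<n'. e j l * (\<Sum>k<n. e i k * D k l)) = (\<Sum>k<n. \<Sum>l<n'. e i k * e j l * D k l)"
      by (subst sum.swap) (simp add: sum_distrib_left mult_ac)
    finally show ?thesis by simp
  qed
  have A_eq: "A k l = (\<Sum>i\<le>n. \<Sum>j\<le>n'. a i j * (e i k * e j l))" if "k < n" "l < n'" for k l
  proof -
    have "(\<Sum>i\<le>n. \<Sum>j\<le>n'. a i j * (e i k * e j l)) = (\<Sum>i\<le>n. if i \<le> k then \<Sum>j\<le>n'. if j \<le> l then a i j else 0 else 0)"
      by (intro sum.cong) (auto simp: e_def intro!: sum.cong)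
    also have "\<dots> = (\<Sum>i\<in>{i\<in>{..n}. i \<le> k}. \<Sum>j\<in>{j\<in>{..n'}. j \<le> l}. a i j)"
      by (simp only: sum.inter_filter finite_atMost)
    also have "{i\<in>{..n}. i \<le> k} = {..k}" using that by auto
    also have "{j\<in>{..n'}. j \<le> l} = {..l}" using that by auto
    finally show ?thesis by (simp add: A_def)
  qed
  have "(\<Sum>i\<le>n. \<Sum>j\<le>n'. a i j * c i j) =
      (\<Sum>i\<le>n. \<Sum>j\<le>n'. a i j * c i n' + a i j * c n j - a i j * c n n'
         + (\<Sum>k<n. \<Sum>l<n'. D k l * (a i j * (e i k * e j l))))"
    by (intro sum.cong refl) (subst c_eq; simp add: algebra_simps sum_distrib_left)
  also have "\<dots> = (\<Sum>i\<le>n. (\<Sum>j\<le>n'. a i j) * c i n') + (\<Sum>j\<le>n'. (\<Sum>i\<le>n. a i j) * c n j)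
      - (\<Sum>i\<le>n. \<Sum>j\<le>n'. a i j) * c n n'
      + (\<Sum>i\<le>n. \<Sum>j\<le>n'. \<Sum>k<n. \<Sum>l<n'. D k l * (a i j * (e i k * e j l)))"
    by (simp add: sum.distrib sum_subtractf sum_distrib_right sum.swap[of "\<lambda>i j. a i j * c n j"])
  also have "(\<Sum>i\<le>n. \<Sum>j\<le>n'. \<Sum>k<n. \<Sum>l<n'. D k l * (a i j * (e i k * e j l)))
      = (\<Sum>(i, j)\<in>{..n}\<times>{..n'}. \<Sum>(k, l)\<in>{..<n}\<times>{..<n'}. D k l * (a i j * (e i k * e j l)))"
    by (simp only: sum.cartesian_product[symmetric])
  also have "\<dots> = (\<Sum>(k, l)\<in>{..<n}\<times>{..<n'}. \<Sum>(i, j)\<in>{..n}\<times>{..n'}. D k l * (a i j * (e i k * e j l)))"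
    unfolding split_beta by (rule sum.swap)
  also have "\<dots> = (\<Sum>k<n. \<Sum>l<n'. D k l * A k l)"
    unfolding sum.cartesian_product[symmetric]
    by (intro sum.cong refl) (simp add: A_eq sum_distrib_left)
  finally show ?thesis using row col by simp
qed

context comonotone_coupling
begin

lemma sum_fst: "(\<Sum>p\<in>P. g p * f (fst p)) = (\<Sum>i<N1. m1 i * f i)"
  by (rule sum_fibres) (use finite_support support fst_marginal in auto)

lemma sum_snd: "(\<Sum>p\<in>P. g p * f (snd p)) = (\<Sum>j<N2. m2 j * f j)"
  by (rule sum_fibres) (use finite_support support snd_marginal in auto)

theorem comonotone_optimal:
  fixes a c :: "nat \<Rightarrow> nat \<Rightarrow> real"
  assumes nn: "\<And>i j. 0 \<le> a i j"
    and row: "\<And>i. i < N1 \<Longrightarrow> (\<Sum>j<N2. a i j) = m1 i"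
    and col: "\<And>j. j < N2 \<Longrightarrow> (\<Sum>i<N1. a i j) = m2 j"
    and monge: "\<And>k l. Suc k < N1 \<Longrightarrow> Suc l < N2 \<Longrightarrow> c k l + c (Suc k) (Suc l) \<le> c (Suc k) l + c k (Suc l)"
  shows "(\<Sum>p\<in>P. g p * c (fst p) (snd p)) \<le> (\<Sum>i<N1. \<Sum>j<N2. a i j * c i j)"
proof (cases "N1 = 0 \<or> N2 = 0")
  case True
  then show ?thesis using support by auto
next
  case False
  then obtain n n' where n: "N1 = Suc n" "N2 = Suc n'"
    using not0_implies_Suc by blast
  define b where "b i j = (if (i, j) \<in> P then g (i, j) else 0)" for i j
  have b_nn: "0 \<le> b i j" for i j
    using weight_pos[of "(i,j)"] by (auto simp: b_def)
  have b_row: "(\<Sum>j<N2. b i j) = m1 i" if "i < N1" for i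
  proof -
    have "(\<Sum>j<N2. b i j) = (\<Sum>j\<in>{j\<in>{..<N2}. (i,j) \<in> P}. g (i,j))"
      by (simp only: b_def sum.inter_filter[OF finite_lessThan])
    also have "\<dots> = (\<Sum>p\<in>{p\<in>P. fst p = i}. g p)"
      by (rule sum.reindex_bij_witness[of _ snd "\<lambda>j. (i, j)"]) (use snd_less in auto)
    finally show ?thesis using fst_marginal[OF that] by simp
  qed
  have b_col: "(\<Sum>i<N1. b i j) = m2 j" if "j < N2" for j
  proof -
    have "(\<Sum>i<N1. b i j) = (\<Sum>i\<in>{i\<in>{..<N1}. (i,j) \<in> P}. g (i,j))"
      by (simp only: b_def sum.inter_filter[OF finite_lessThan])
    also have "\<dots> = (\<Sum>p\<in>{p\<in>P. snd p = j}. g p)"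
      by (rule sum.reindex_bij_witness[of _ fst "\<lambda>i. (i, j)"]) (use fst_less in auto)
    finally show ?thesis using snd_marginal[OF that] by simp
  qed
  have b_sum: "(\<Sum>p\<in>P. g p * c (fst p) (snd p)) = (\<Sum>i<N1. \<Sum>j<N2. b i j * c i j)"
  proof -
    have "(\<Sum>i<N1. \<Sum>j<N2. b i j * c i j) = (\<Sum>p\<in>{..<N1}\<times>{..<N2}. if p \<in> P then g p * c (fst p) (snd p) else 0)"
      unfolding sum.cartesian_product by (intro sum.cong) (auto simp: b_def)
    also have "\<dots> = (\<Sum>p\<in>{p\<in>{..<N1}\<times>{..<N2}. p \<in> P}. g p * c (fst p) (snd p))"
      by (rule sum.inter_filter[symmetric]) auto
    also have "{p\<in>{..<N1}\<times>{..<N2}. p \<in> P} = P" using support by auto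
    finally show ?thesis by simp
  qed
  define A where "A k l = (\<Sum>i\<le>k. \<Sum>j\<le>l. a i j)" for k l
  define B where "B k l = (\<Sum>i\<le>k. \<Sum>j\<le>l. b i j)" for k l
  have A_le: "A k l \<le> B k l" if kl: "k < n" "l < n'" for k l
  proof -
    have A1: "A k l \<le> (\<Sum>i\<le>k. m1 i)"
    proof -
      have "(\<Sum>j\<le>l. a i j) \<le> m1 i" if "i \<le> k" for i
        using that kl n nn by (subst row[symmetric]) (simp, intro sum_mono2, auto)
      then show ?thesis unfolding A_def by (intro sum_mono) auto
    qed
    have A2: "A k l \<le> (\<Sum>j\<le>l. m2 j)"
    proof -
      have "(\<Sum>i\<le>k. a i j) \<le> m2 j" if "j \<le> l" for j
        using that kl n nn by (subst col[symmetric]) (simp, intro sum_mono2, auto)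
      then show ?thesis unfolding A_def by (subst sum.swap) (intro sum_mono, auto)
    qed
    show ?thesis
    proof (cases "\<exists>i\<le>k. \<exists>j>l. b i j \<noteq> 0")
      case True
      then obtain i j where ij: "i \<le> k" "l < j" "(i, j) \<in> P" by (auto simp: b_def split: if_splits)
      have zero: "i' \<le> k" if "b i' j' \<noteq> 0" "j' \<le> l" for i' j'
        using comonotone[OF ij(3), of "(i', j')"] ij that by (fastforce simp: b_def split: if_splits)
      have "(\<Sum>i\<le>k. b i j) = m2 j" if "j \<le> l" for j
        using that kl n zero[of _ j]
        by (subst b_col[symmetric]) (simp, intro sum.mono_neutral_left, auto)
      then have "B k l = (\<Sum>j\<le>l. m2 j)"
        unfolding B_def by (subst sum.swap) auto
      then show ?thesis using A2 by simp
    next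
      case F: False
      have "(\<Sum>j\<le>l. b i j) = m1 i" if "i \<le> k" for i
        using that kl n F by (subst b_row[symmetric]) (simp, intro sum.mono_neutral_left, auto simp: not_less)
      then have "B k l = (\<Sum>i\<le>k. m1 i)" unfolding B_def by auto
      then show ?thesis using A1 by simp
    qed
  qed
  let ?D = "\<lambda>k l. c k l + c (Suc k) (Suc l) - c (Suc k) l - c k (Suc l)"
  have "(\<Sum>k<n. \<Sum>l<n'. ?D k l * B k l) \<le> (\<Sum>k<n. \<Sum>l<n'. ?D k l * A k l)"
  proof (intro sum_mono)
    fix k l assume "k \<in> {..<n}" "l \<in> {..<n'}"
    then show "?D k l * B k l \<le> ?D k l * A k l"
      using monge[of k l] A_le[of k l] n by (intro mult_left_mono_neg) auto
  qed
  moreover have "(\<Sum>i\<le>n. \<Sum>j\<le>n'. a i j * c i j) =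
      (\<Sum>i\<le>n. m1 i * c i n') + (\<Sum>j\<le>n'. m2 j * c n j) - (\<Sum>i\<le>n. m1 i) * c n n'
      + (\<Sum>k<n. \<Sum>l<n'. ?D k l * A k l)"
    unfolding A_def
    by (rule cost_by_parts) (use row col n in \<open>auto simp: lessThan_Suc_atMost\<close>)
  moreover have "(\<Sum>i\<le>n. \<Sum>j\<le>n'. b i j * c i j) =
      (\<Sum>i\<le>n. m1 i * c i n') + (\<Sum>j\<le>n'. m2 j * c n j) - (\<Sum>i\<le>n. m1 i) * c n n'
      + (\<Sum>k<n. \<Sum>l<n'. ?D k l * B k l)"
    unfolding B_def
    by (rule cost_by_parts) (use b_row b_col n in \<open>auto simp: lessThan_Suc_atMost\<close>)
  ultimately show ?thesis
    unfolding b_sum n lessThan_Suc_atMost by linarith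
qed

end

section \<open>Contraction for convex costs\<close>

locale sticky_pair =
  S1: sticky_particles N1 m1 x1 v1 X1 V1 + S2: sticky_particles N2 m2 x2 v2 X2 V2 +
  comonotone_coupling N1 N2 m1 m2 P g
  for N1 m1 x1 v1 X1 V1 N2 m2 x2 v2 X2 V2 P g
begin

lemma polar_lift_fst:
  assumes "\<And>z. cluster_mono N1 X1 t z \<Longrightarrow> (\<Sum>i<N1. m1 i * h i * z i) \<le> 0"
    and "\<And>p q. p \<in> P \<Longrightarrow> q \<in> P \<Longrightarrow> fst p < fst q \<Longrightarrow> X1 (fst p) t = X1 (fst q) t \<Longrightarrow> z p \<le> z q"
  shows "(\<Sum>p\<in>P. g p * h (fst p) * z p) \<le> 0"
  by (rule polar_lift[where k=fst, OF finite_support _ weight_pos fst_marginal S1.mass_pos assms])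
     (use fst_less in auto)

lemma polar_lift_snd:
  assumes "\<And>z. cluster_mono N2 X2 t z \<Longrightarrow> (\<Sum>i<N2. m2 i * h i * z i) \<le> 0"
    and "\<And>p q. p \<in> P \<Longrightarrow> q \<in> P \<Longrightarrow> snd p < snd q \<Longrightarrow> X2 (snd p) t = X2 (snd q) t \<Longrightarrow> z p \<le> z q"
  shows "(\<Sum>p\<in>P. g p * h (snd p) * z p) \<le> 0"
  by (rule polar_lift[where k=snd, OF finite_support _ weight_pos snd_marginal S2.mass_pos assms])
     (use snd_less in auto)

text \<open>Let \<open>d\<close> be the difference of the sticky positions, \<open>e\<close> that of the free ones, and \<open>s\<close> a
  monotone selection of subgradients of \<open>\<phi>\<close>. Then \<open>\<phi> e - \<phi> d\<close> is at least
  \<open>s d * (e - d)\<close>, and \<open>e - d\<close> is the displacement of the first system minus that of the second. On a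
  cluster of the first system \<open>- s d\<close> is nondecreasing along the coupling, on a cluster of the second
  one \<open>s d\<close> is, so both displacements have the right sign.\<close>

lemma convex_contraction:
  fixes \<phi> :: "real \<Rightarrow> real"
  defines "d \<equiv> \<lambda>t p. X1 (fst p) t - X2 (snd p) t"
    and "e \<equiv> \<lambda>t p. x1 (fst p) + t * v1 (fst p) - (x2 (snd p) + t * v2 (snd p))"
  assumes I: "convex_on I \<phi>" "open I" and t: "0 \<le> t"
    and dI: "\<And>p. p \<in> P \<Longrightarrow> d t p \<in> I" and eI: "\<And>p. p \<in> P \<Longrightarrow> e t p \<in> I"
  shows "(\<Sum>p\<in>P. g p * \<phi> (d t p)) \<le> (\<Sum>p\<in>P. g p * \<phi> (e t p))"
proof -
  define s where "s y = Inf ((\<lambda>u. (\<phi> y - \<phi> u) / (y - u)) ` ({y<..} \<inter> I))" for y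
  have sub: "\<phi> y + s y * (u - y) \<le> \<phi> u" if "y \<in> I" "u \<in> I" for y u
    using convex_le_Inf_differential[OF I(1), of y u] that I(2) by (simp add: s_def interior_open)
  have s_mono: "s y \<le> s u" if "y \<le> u" "y \<in> I" "u \<in> I" for y u
  proof (cases "y = u")
    case False
    have "(s y - s u) * (u - y) \<le> 0"
      using sub[of y u] sub[of u y] that by (simp add: algebra_simps)
    then show ?thesis using False that by (simp add: mult_le_0_iff)
  qed simp
  have 1: "(\<Sum>p\<in>P. g p * (x1 (fst p) + t * v1 (fst p) - X1 (fst p) t) * (- s (d t p))) \<le> 0"
  proof (rule polar_lift_fst[where h="\<lambda>i. x1 i + t * v1 i - X1 i t", OF S1.displacement_polar[OF t]])
    fix p q assume pq: "p \<in> P" "q \<in> P" "fst p < fst q" "X1 (fst p) t = X1 (fst q) t"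
    have "X2 (snd p) t \<le> X2 (snd q) t"
      using pq comonotone snd_less t by (intro S2.position_ordered) auto
    then show "- s (d t p) \<le> - s (d t q)"
      using pq s_mono[OF _ dI[of q] dI[of p]] by (simp add: d_def)
  qed
  have 2: "(\<Sum>p\<in>P. g p * (x2 (snd p) + t * v2 (snd p) - X2 (snd p) t) * s (d t p)) \<le> 0"
  proof (rule polar_lift_snd[where h="\<lambda>i. x2 i + t * v2 i - X2 i t", OF S2.displacement_polar[OF t]])
    fix p q assume pq: "p \<in> P" "q \<in> P" "snd p < snd q" "X2 (snd p) t = X2 (snd q) t"
    have "X1 (fst p) t \<le> X1 (fst q) t"
      using pq comonotone_snd fst_less t by (intro S1.position_ordered) auto
    then show "s (d t p) \<le> s (d t q)"
      using pq s_mono[OF _ dI[of p] dI[of q]] by (simp add: d_def)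
  qed
  have "(\<Sum>p\<in>P. g p * \<phi> (d t p)) + (\<Sum>p\<in>P. g p * (s (d t p) * (e t p - d t p)))
      \<le> (\<Sum>p\<in>P. g p * \<phi> (e t p))"
    unfolding sum.distrib[symmetric] distrib_left[symmetric]
    using sub dI eI weight_pos by (intro sum_mono mult_left_mono) (auto intro: less_imp_le)
  moreover have "(\<Sum>p\<in>P. g p * (s (d t p) * (e t p - d t p))) =
     - (\<Sum>p\<in>P. g p * (x1 (fst p) + t * v1 (fst p) - X1 (fst p) t) * (- s (d t p)))
     - (\<Sum>p\<in>P. g p * (x2 (snd p) + t * v2 (snd p) - X2 (snd p) t) * s (d t p))"
    unfolding sum_negf[symmetric] sum_subtractf[symmetric]
    by (intro sum.cong) (auto simp: d_def e_def algebra_simps)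
  ultimately show ?thesis using 1 2 by linarith
qed

end

lemma convex_enn_even_mono:
  assumes "convex_enn \<psi>" "\<And>z. \<psi> (- z) = \<psi> z" "\<bar>x\<bar> \<le> \<bar>y\<bar>"
  shows "\<psi> x \<le> \<psi> y"
proof (cases "y = 0")
  case False
  define u where "u = (x + y) / (2 * y)"
  have u: "0 \<le> u" "u \<le> 1"
    using False assms(3) by (cases "y > 0"; simp add: u_def field_simps abs_if split: if_splits)+
  have x: "x = (1 - u) * (- y) + u * y"
    using False by (simp add: u_def field_simps)
  have "\<psi> x \<le> ennreal (1 - u) * \<psi> (- y) + ennreal u * \<psi> y"
    using assms(1) u unfolding convex_enn_def by (subst x) (metis atLeastAtMost_iff)
  also have "\<dots> = (ennreal (1 - u) + ennreal u) * \<psi> y"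
    by (simp add: assms(2) distrib_right)
  also have "ennreal (1 - u) + ennreal u = 1"
    using u by (simp add: ennreal_plus[symmetric] del: ennreal_plus)
  finally show ?thesis by simp
qed (use assms in auto)

lemma convex_on_enn2real:
  assumes \<psi>: "convex_enn \<psi>" and fin: "\<And>z. z \<in> I \<Longrightarrow> \<psi> (l * z) < \<infinity>" and I: "convex I"
  shows "convex_on I (\<lambda>z. enn2real (\<psi> (l * z)))"
proof (rule convex_onI[OF _ I])
  fix u x y :: real assume u: "0 < u" "u < 1" and xy: "x \<in> I" "y \<in> I"
  have "\<psi> ((1 - u) * (l * x) + u * (l * y)) \<le> ennreal (1 - u) * \<psi> (l * x) + ennreal u * \<psi> (l * y)"
    using \<psi> u unfolding convex_enn_def by auto
  moreover have "\<psi> (l * x) = ennreal (enn2real (\<psi> (l * x)))" "\<psi> (l * y) = ennreal (enn2real (\<psi> (l * y)))"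
    using fin xy by (simp_all add: less_top)
  ultimately have "\<psi> ((1 - u) * (l * x) + u * (l * y))
      \<le> ennreal ((1 - u) * enn2real (\<psi> (l * x)) + u * enn2real (\<psi> (l * y)))"
    using u by (simp add: ennreal_mult ennreal_plus)
  then have "enn2real (\<psi> ((1 - u) * (l * x) + u * (l * y)))
      \<le> (1 - u) * enn2real (\<psi> (l * x)) + u * enn2real (\<psi> (l * y))"
    using u by (intro enn2real_leI) auto
  then show "enn2real (\<psi> (l * ((1 - u) *\<^sub>R x + u *\<^sub>R y)))
      \<le> (1 - u) * enn2real (\<psi> (l * x)) + u * enn2real (\<psi> (l * y))"
    by (simp add: algebra_simps)
qed

text \<open>Lower semicontinuity excludes an upward jump at the boundary of the domain of \<open>\<psi>\<close>.\<close>

lemma dilation_tendsto: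
  assumes \<psi>: "convex_enn \<psi>" "\<And>z. \<psi> (- z) = \<psi> z" "lower_semicontinuous \<psi>"
    and l: "l \<longlonglongrightarrow> 1" "\<And>n. 0 < l n" "\<And>n. l n < (1::real)"
  shows "(\<lambda>n. \<psi> (l n * z)) \<longlonglongrightarrow> \<psi> z"
proof (cases "z = 0")
  case False
  have lim: "filterlim (\<lambda>n. l n * z) (at z) sequentially"
  proof (rule filterlim_atI)
    show "(\<lambda>n. l n * z) \<longlonglongrightarrow> z" using tendsto_mult_right[OF l(1), of z] by simp
    show "\<forall>\<^sub>F n in sequentially. l n * z \<noteq> z" using l(3) False by (simp add: less_imp_neq)
  qed
  show ?thesis
  proof (rule order_tendstoI)
    fix a assume "a < \<psi> z"
    then have "a < Liminf (at z) \<psi>"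
      using \<psi>(3) unfolding lower_semicontinuous_def by (meson order_less_le_trans)
    then have "\<forall>\<^sub>F y in at z. a < \<psi> y" by (rule less_LiminfD)
    then show "\<forall>\<^sub>F n in sequentially. a < \<psi> (l n * z)"
      using lim by (rule eventually_compose_filterlim)
  next
    fix a assume "\<psi> z < a"
    moreover have "\<psi> (l n * z) \<le> \<psi> z" for n
      using l(2,3)[of n] by (intro convex_enn_even_mono[OF \<psi>(1,2)])
        (simp add: abs_mult mult_left_le_one_le)
    ultimately show "\<forall>\<^sub>F n in sequentially. \<psi> (l n * z) < a"
      by (meson always_eventually order_le_less_trans)
  qed
qed simp

context sticky_pair
begin

text \<open>For extended-valued \<open>\<psi>\<close> the real-valued contraction is applied to \<open>\<lambda>z. \<psi> (l * z)\<close> with \<open>l < 1\<close>.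
  This function is finite on a neighbourhood of all differences that occur: the free ones are at most some
  \<open>R\<close> with \<open>\<psi> R < \<infinity>\<close>, and the contraction for \<open>max 0 (\<bar>z\<bar> - R)\<close> bounds the sticky ones by \<open>R\<close> as well.\<close>

theorem convex_enn_contraction:
  defines "d \<equiv> \<lambda>t p. X1 (fst p) t - X2 (snd p) t"
    and "e \<equiv> \<lambda>t p. x1 (fst p) + t * v1 (fst p) - (x2 (snd p) + t * v2 (snd p))"
  assumes \<psi>: "convex_enn \<psi>" "\<And>z. \<psi> (- z) = \<psi> z" "lower_semicontinuous \<psi>" and t: "0 \<le> t"
  shows "(\<Sum>p\<in>P. ennreal (g p) * \<psi> (d t p)) \<le> (\<Sum>p\<in>P. ennreal (g p) * \<psi> (e t p))"
proof (cases "P = {} \<or> (\<exists>p\<in>P. \<psi> (e t p) = \<infinity>)")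
  case True
  then show ?thesis
  proof
    assume "\<exists>p\<in>P. \<psi> (e t p) = \<infinity>"
    then obtain p where p: "p \<in> P" "\<psi> (e t p) = \<infinity>" by auto
    have "ennreal (g p) * \<psi> (e t p) = \<infinity>"
      using p weight_pos[of p] by (simp add: ennreal_mult_top)
    then have "(\<Sum>p\<in>P. ennreal (g p) * \<psi> (e t p)) = \<infinity>"
      using member_le_sum[OF p(1), of "\<lambda>p. ennreal (g p) * \<psi> (e t p)"] finite_support
      by (simp add: top_unique)
    then show ?thesis by simp
  qed simp
next
  case False
  note \<psi>_mono = convex_enn_even_mono[OF \<psi>(1,2)]
  define R where "R = Max ((\<lambda>p. \<bar>e t p\<bar>) ` P)"
  have e_le: "\<bar>e t p\<bar> \<le> R" if "p \<in> P" for p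
    using that finite_support by (auto simp: R_def)
  have "R \<in> (\<lambda>p. \<bar>e t p\<bar>) ` P" unfolding R_def using finite_support False by (intro Max_in) auto
  then obtain p0 where p0: "p0 \<in> P" "R = \<bar>e t p0\<bar>" by auto
  have R0: "0 \<le> R" using p0 by simp
  have fin: "\<psi> z < \<infinity>" if "\<bar>z\<bar> \<le> R" for z
    using \<psi>_mono[of z "e t p0"] that p0 False by (auto simp: less_top[symmetric] top_unique)
  have d_le: "\<bar>d t p\<bar> \<le> R" if "p \<in> P" for p
  proof -
    have "convex_on UNIV (\<lambda>z::real. max 0 (\<bar>z\<bar> - R))"
    proof (rule convex_onI)
      fix u x y :: real assume "0 < u" "u < 1"
      then have "\<bar>(1 - u) * x + u * y\<bar> \<le> (1 - u) * \<bar>x\<bar> + u * \<bar>y\<bar>"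
        using abs_triangle_ineq[of "(1 - u) * x" "u * y"] by (simp add: abs_mult)
      then have "\<bar>(1 - u) * x + u * y\<bar> - R \<le> (1 - u) * (\<bar>x\<bar> - R) + u * (\<bar>y\<bar> - R)"
        by (simp add: algebra_simps)
      also have "\<dots> \<le> (1 - u) * max 0 (\<bar>x\<bar> - R) + u * max 0 (\<bar>y\<bar> - R)"
        using \<open>0 < u\<close> \<open>u < 1\<close> by (intro add_mono mult_left_mono) auto
      finally show "max 0 (\<bar>(1 - u) *\<^sub>R x + u *\<^sub>R y\<bar> - R)
          \<le> (1 - u) * max 0 (\<bar>x\<bar> - R) + u * max 0 (\<bar>y\<bar> - R)"
        using \<open>0 < u\<close> \<open>u < 1\<close> by simp
    qed simp
    from convex_contraction[OF this _ t]
    have "(\<Sum>p\<in>P. g p * max 0 (\<bar>d t p\<bar> - R)) \<le> (\<Sum>p\<in>P. g p * max 0 (\<bar>e t p\<bar> - R))"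
      by (simp add: d_def e_def)
    also have "\<dots> = 0" using e_le by (intro sum.neutral) auto
    finally have "(\<Sum>p\<in>P. g p * max 0 (\<bar>d t p\<bar> - R)) = 0"
      using less_imp_le[OF weight_pos] by (intro antisym sum_nonneg mult_nonneg_nonneg) auto
    then have "g p * max 0 (\<bar>d t p\<bar> - R) = 0"
      using that finite_support less_imp_le[OF weight_pos]
      by (subst (asm) sum_nonneg_eq_0_iff) (auto intro!: mult_nonneg_nonneg)
    then show ?thesis using weight_pos[OF that] by (simp split: if_splits add: max_def)
  qed
  show ?thesis
  proof (cases "R = 0")
    case True
    then show ?thesis using d_le e_le by simp
  next
    case False
    with R0 have R: "0 < R" by simp
    have scaled: "(\<Sum>p\<in>P. ennreal (g p) * \<psi> (l * d t p)) \<le> (\<Sum>p\<in>P. ennreal (g p) * \<psi> (e t p))"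
      if l: "0 < l" "l < 1" for l
    proof -
      let ?I = "{- (R / l)<..<R / l}"
      have "R * l < R" using l R by simp
      then have Rl: "R < R / l" using l by (simp add: field_simps)
      have finI: "\<psi> (l * z) < \<infinity>" if "z \<in> ?I" for z
        using that l by (intro fin) (auto simp: abs_le_iff field_simps)
      have cI: "convex_on ?I (\<lambda>z. enn2real (\<psi> (l * z)))"
        by (intro convex_on_enn2real \<psi>(1) finI) auto
      have in_I: "d t p \<in> ?I" "e t p \<in> ?I" if "p \<in> P" for p
        using d_le[OF that] e_le[OF that] Rl by auto
      have "(\<Sum>p\<in>P. g p * enn2real (\<psi> (l * d t p))) \<le> (\<Sum>p\<in>P. g p * enn2real (\<psi> (l * e t p)))"
        using convex_contraction[OF cI _ t] in_I by (simp add: d_def e_def)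
      moreover have "ennreal (g p) * \<psi> (l * z) = ennreal (g p * enn2real (\<psi> (l * z)))"
        if "p \<in> P" "z \<in> ?I" for p z
        using finI[OF that(2)] weight_pos[OF that(1)] by (simp add: ennreal_mult less_top)
      ultimately have "(\<Sum>p\<in>P. ennreal (g p) * \<psi> (l * d t p)) \<le> (\<Sum>p\<in>P. ennreal (g p) * \<psi> (l * e t p))"
        using weight_pos in_I by (simp add: sum_ennreal less_imp_le ennreal_leI)
      also have "\<dots> \<le> (\<Sum>p\<in>P. ennreal (g p) * \<psi> (e t p))"
        using l by (intro sum_mono mult_left_mono \<psi>_mono) (auto simp: abs_mult mult_left_le_one_le)
      finally show ?thesis .
    qed
    define l where "l n = 1 - inverse (real n + 2)" for n
    have l: "0 < l n" "l n < 1" for n by (auto simp: l_def field_simps)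
    have l_lim: "l \<longlonglongrightarrow> 1" unfolding l_def by real_asymp
    have "(\<lambda>n. \<Sum>p\<in>P. ennreal (g p) * \<psi> (l n * d t p)) \<longlonglongrightarrow> (\<Sum>p\<in>P. ennreal (g p) * \<psi> (d t p))"
      by (intro tendsto_sum ennreal_tendsto_cmult dilation_tendsto[OF \<psi> l_lim] l) simp
    then show ?thesis
      by (rule LIMSEQ_le_const2) (use scaled l in blast)
  qed
qed

end

section \<open>Powers of the distance\<close>

lemma powr_convex_nonneg:
  assumes p: "1 \<le> p" and ab: "0 \<le> a" "0 \<le> b" and u: "0 \<le> u" "u \<le> 1"
  shows "((1 - u) * a + u * b) powr p \<le> (1 - u) * a powr p + u * b powr (p::real)"
proof -
  have shrink: "(c * b) powr p \<le> c * b powr p" if "0 \<le> c" "c \<le> 1" "0 \<le> b" for b c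
  proof (cases "c = 0")
    case False
    then have "c powr p \<le> c powr 1" using that p by (intro powr_mono') auto
    then show ?thesis using that False by (simp add: powr_mult mult_right_mono)
  qed simp
  show ?thesis
  proof (cases "a = 0 \<or> b = 0")
    case True
    then show ?thesis
      using shrink[of "1 - u" a] shrink[of u b] assms by auto
  next
    case False
    then show ?thesis
      using convex_onD[OF powr_convex[OF p], of u a b] assms by auto
  qed
qed

lemma convex_on_abs_powr:
  assumes p: "1 \<le> (p::real)"
  shows "convex_on UNIV (\<lambda>z. \<bar>z\<bar> powr p)"
proof (rule convex_onI)
  fix u x y :: real assume u: "0 < u" "u < 1"
  have "\<bar>(1 - u) * x + u * y\<bar> powr p \<le> ((1 - u) * \<bar>x\<bar> + u * \<bar>y\<bar>) powr p"
    using u p abs_triangle_ineq[of "(1 - u) * x" "u * y"] by (intro powr_mono2) (auto simp: abs_mult)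
  also have "\<dots> \<le> (1 - u) * \<bar>x\<bar> powr p + u * \<bar>y\<bar> powr p"
    using u p by (intro powr_convex_nonneg) auto
  finally show "\<bar>(1 - u) *\<^sub>R x + u *\<^sub>R y\<bar> powr p \<le> (1 - u) * \<bar>x\<bar> powr p + u * \<bar>y\<bar> powr p"
    by simp
qed simp

text \<open>The two inner points \<open>x - y\<close> and \<open>x' - y'\<close> are convex combinations, with exchanged weights,
  of the two outer ones.\<close>

lemma convex_monge:
  fixes \<phi> :: "real \<Rightarrow> real"
  assumes \<phi>: "convex_on UNIV \<phi>" and xy: "x < x'" "y < y'"
  shows "\<phi> (x - y) + \<phi> (x' - y') \<le> \<phi> (x' - y) + \<phi> (x - y')"
proof -
  define a b where "a = x - y'" and "b = x' - y"
  define u where "u = (y' - y) / (b - a)"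
  have ba: "0 < b - a" using xy by (simp add: a_def b_def)
  have u: "0 \<le> u" "u \<le> 1" using xy ba by (auto simp: u_def a_def b_def)
  have "u * (b - a) = y' - y" using ba by (simp add: u_def)
  then have "x - y = (1 - u) * a + u * b" "x' - y' = (1 - (1 - u)) * a + (1 - u) * b"
    by (simp_all add: algebra_simps a_def b_def)
  then have "\<phi> (x - y) \<le> (1 - u) * \<phi> a + u * \<phi> b" "\<phi> (x' - y') \<le> u * \<phi> a + (1 - u) * \<phi> b"
    using convex_onD[OF \<phi>, of u a b] convex_onD[OF \<phi>, of "1 - u" a b] u by auto
  then show ?thesis unfolding a_def b_def by (simp add: algebra_simps)
qed

text \<open>Minkowski's inequality, from the convexity of the power applied to the normalised vectors.\<close>

lemma minkowski_le:
  fixes w a b :: "'i \<Rightarrow> real"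
  assumes p: "1 \<le> p" and w: "\<And>i. i \<in> I \<Longrightarrow> 0 \<le> w i" and AB: "0 < A" "0 < B"
    and a: "(\<Sum>i\<in>I. w i * \<bar>a i\<bar> powr p) \<le> A powr p" and b: "(\<Sum>i\<in>I. w i * \<bar>b i\<bar> powr p) \<le> B powr p"
  shows "(\<Sum>i\<in>I. w i * \<bar>a i + b i\<bar> powr p) \<le> (A + B) powr p"
proof -
  define u where "u = B / (A + B)"
  have u: "0 \<le> u" "u \<le> 1" "1 - u = A / (A + B)" using AB by (auto simp: u_def field_simps)
  have pt: "\<bar>a i + b i\<bar> powr p \<le>
      (A + B) powr p * ((1 - u) * (\<bar>a i\<bar> powr p / A powr p) + u * (\<bar>b i\<bar> powr p / B powr p))" for i
  proof -
    have "\<bar>a i + b i\<bar> \<le> (A + B) * ((1 - u) * (\<bar>a i\<bar> / A) + u * (\<bar>b i\<bar> / B))"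
      using AB abs_triangle_ineq[of "a i" "b i"] unfolding u(3) by (simp add: u_def distrib_left)
    then have "\<bar>a i + b i\<bar> powr p \<le> ((A + B) * ((1 - u) * (\<bar>a i\<bar> / A) + u * (\<bar>b i\<bar> / B))) powr p"
      using p by (intro powr_mono2) auto
    also have "\<dots> = (A + B) powr p * ((1 - u) * (\<bar>a i\<bar> / A) + u * (\<bar>b i\<bar> / B)) powr p"
      using AB u(1,2) by (intro powr_mult)
    also have "\<dots> \<le> (A + B) powr p * ((1 - u) * (\<bar>a i\<bar> / A) powr p + u * (\<bar>b i\<bar> / B) powr p)"
      using p u AB by (intro mult_left_mono powr_convex_nonneg) auto
    finally show ?thesis using AB by (simp add: powr_divide)
  qed
  have "(\<Sum>i\<in>I. w i * \<bar>a i + b i\<bar> powr p) \<le> (\<Sum>i\<in>I. w i * ((A + B) powr p *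
      ((1 - u) * (\<bar>a i\<bar> powr p / A powr p) + u * (\<bar>b i\<bar> powr p / B powr p))))"
    by (intro sum_mono mult_left_mono pt w)
  also have "\<dots> = (A + B) powr p * ((1 - u) * ((\<Sum>i\<in>I. w i * \<bar>a i\<bar> powr p) / A powr p)
      + u * ((\<Sum>i\<in>I. w i * \<bar>b i\<bar> powr p) / B powr p))"
    by (simp add: sum_distrib_left sum.distrib sum_divide_distrib algebra_simps)
  also have "\<dots> \<le> (A + B) powr p * ((1 - u) * 1 + u * 1)"
    using a b u AB by (intro mult_left_mono add_mono) (auto simp: divide_le_eq_1)
  finally show ?thesis by simp
qed

lemma minkowski_sum:
  fixes w a b :: "'i \<Rightarrow> real"
  assumes p: "1 \<le> p" and w: "\<And>i. i \<in> I \<Longrightarrow> 0 \<le> w i"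
  shows "(\<Sum>i\<in>I. w i * \<bar>a i + b i\<bar> powr p) powr (1 / p) \<le>
     (\<Sum>i\<in>I. w i * \<bar>a i\<bar> powr p) powr (1 / p) + (\<Sum>i\<in>I. w i * \<bar>b i\<bar> powr p) powr (1 / p)"
proof (rule field_le_epsilon)
  let ?n = "\<lambda>f. \<Sum>i\<in>I. w i * \<bar>f i\<bar> powr p"
  fix \<epsilon> :: real assume \<epsilon>: "0 < \<epsilon>"
  have nn: "0 \<le> ?n f" for f by (intro sum_nonneg mult_nonneg_nonneg w) auto
  let ?A = "?n a powr (1 / p) + \<epsilon> / 2" and ?B = "?n b powr (1 / p) + \<epsilon> / 2"
  have bound: "?n f \<le> (?n f powr (1 / p) + \<epsilon> / 2) powr p" for f
  proof -
    have "?n f = (?n f powr (1 / p)) powr p" using nn[of f] p by (simp add: powr_powr)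
    also have "\<dots> \<le> (?n f powr (1 / p) + \<epsilon> / 2) powr p" using \<epsilon> p by (intro powr_mono2) auto
    finally show ?thesis .
  qed
  have pos: "0 < ?n f powr (1 / p) + \<epsilon> / 2" for f
    using \<epsilon> by (intro add_nonneg_pos) auto
  have "(\<Sum>i\<in>I. w i * \<bar>a i + b i\<bar> powr p) \<le> (?A + ?B) powr p"
    by (rule minkowski_le[OF p w pos pos bound bound])
  then have "(\<Sum>i\<in>I. w i * \<bar>a i + b i\<bar> powr p) powr (1 / p) \<le> ((?A + ?B) powr p) powr (1 / p)"
    using p nn[of "\<lambda>i. a i + b i"] by (intro powr_mono2) auto
  also have "\<dots> = ?A + ?B" using pos[of a] pos[of b] p by (simp add: powr_powr)
  finally show "(\<Sum>i\<in>I. w i * \<bar>a i + b i\<bar> powr p) powr (1 / p)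
     \<le> ?n a powr (1 / p) + ?n b powr (1 / p) + \<epsilon>" by simp
qed

section \<open>Stability of the velocities\<close>

text \<open>The inner product of \<open>L\<^sup>2\<close> for a measure with weights \<open>w\<close> on a finite set \<open>P\<close>.\<close>

definition wip :: "'i set \<Rightarrow> ('i \<Rightarrow> real) \<Rightarrow> ('i \<Rightarrow> real) \<Rightarrow> ('i \<Rightarrow> real) \<Rightarrow> real" where
  "wip P w f h = (\<Sum>p\<in>P. w p * f p * h p)"

lemma wip_commute: "wip P w f h = wip P w h f"
  by (simp add: wip_def mult_ac)

lemma wip_diff_left: "wip P w (\<lambda>p. f p - f' p) h = wip P w f h - wip P w f' h"
  and wip_diff_right: "wip P w h (\<lambda>p. f p - f' p) = wip P w h f - wip P w h f'"
  and wip_scale_left: "wip P w (\<lambda>p. c * f p) h = c * wip P w f h"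
  and wip_scale_right: "wip P w h (\<lambda>p. c * f p) = c * wip P w h f"
  by (simp_all add: wip_def algebra_simps sum_subtractf sum_distrib_left)

lemmas wip_bilinear = wip_diff_left wip_diff_right wip_scale_left wip_scale_right

lemma wip_nonneg: "(\<And>p. p \<in> P \<Longrightarrow> 0 < w p) \<Longrightarrow> 0 \<le> wip P w f f"
  unfolding wip_def by (intro sum_nonneg) (simp add: mult.assoc less_imp_le)

lemma wip_cauchy_schwarz:
  assumes w: "\<And>p. p \<in> P \<Longrightarrow> 0 < w p" and "wip P w f f \<le> a\<^sup>2" "wip P w h h \<le> b\<^sup>2" "0 \<le> a" "0 \<le> b"
  shows "\<bar>wip P w f h\<bar> \<le> a * b"
proof -
  have "(wip P w f h)\<^sup>2 = (\<Sum>p\<in>P. (sqrt (w p) * f p) * (sqrt (w p) * h p))\<^sup>2"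
    unfolding wip_def using w
    by (intro arg_cong[of _ _ "\<lambda>z. z\<^sup>2"] sum.cong) (auto simp: less_imp_le algebra_simps)
  also have "\<dots> \<le> (\<Sum>p\<in>P. (sqrt (w p) * f p)\<^sup>2) * (\<Sum>p\<in>P. (sqrt (w p) * h p)\<^sup>2)"
    by (rule Cauchy_Schwarz_ineq_sum)
  also have "\<dots> = wip P w f f * wip P w h h"
    unfolding wip_def using w
    by (intro arg_cong2[where f="(*)"] sum.cong) (auto simp: less_imp_le power_mult_distrib power2_eq_square)
  also have "\<dots> \<le> a\<^sup>2 * b\<^sup>2"
    using assms by (intro mult_mono wip_nonneg) auto
  finally show ?thesis
    using assms(4,5) by (simp add: power_mult_distrib[symmetric] abs_le_square_iff[symmetric])
qed

lemma integrable_bounded_measurable: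
  fixes f :: "real \<Rightarrow> real"
  assumes "f \<in> borel_measurable borel" "\<And>r. r \<in> {a..b} \<Longrightarrow> \<bar>f r\<bar> \<le> B"
  shows "f integrable_on {a..b}"
proof (rule measurable_bounded_by_integrable_imp_integrable)
  show "f \<in> borel_measurable (lebesgue_on {a..b})"
    using assms(1) by (intro measurable_restrict_space1 measurable_completion) simp
  show "(\<lambda>_. B) integrable_on {a..b}" by (rule integrable_const_ivl)
qed (use assms in auto)

lemma right_derivative_measurable:
  fixes f f' :: "real \<Rightarrow> real"
  assumes cont: "continuous_on {0..} f"
    and deriv: "\<And>r. 0 \<le> r \<Longrightarrow> (f has_real_derivative f' r) (at_right r)"
  shows "(\<lambda>r. f' (max 0 r)) \<in> borel_measurable borel"
proof (rule borel_measurable_LIMSEQ_real)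
  define e where "e n = inverse (real (Suc n))" for n
  have e: "0 < e n" for n by (simp add: e_def)
  have e_lim: "e \<longlonglongrightarrow> 0" unfolding e_def by (rule LIMSEQ_inverse_real_of_nat)
  show "(\<lambda>n. (f (max 0 r + e n) - f (max 0 r)) / e n) \<longlonglongrightarrow> f' (max 0 r)" for r
  proof -
    have "filterlim (\<lambda>n. max 0 r + e n) (at_right (max 0 r)) sequentially"
      using tendsto_add[OF tendsto_const e_lim, of "max 0 r"] e
      by (simp add: filterlim_at less_imp_neq[OF e, symmetric])
    from filterlim_compose[OF deriv[of "max 0 r", unfolded has_field_derivative_iff] this]
    show ?thesis by simp
  qed
  have "(\<lambda>r. f (max 0 r + c)) \<in> borel_measurable borel" if "0 \<le> c" for c
    using that by (intro borel_measurable_continuous_onI continuous_on_compose2[OF cont] continuous_intros) auto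
  from this[OF less_imp_le[OF e]] this[of 0]
  show "(\<lambda>r. (f (max 0 r + e n) - f (max 0 r)) / e n) \<in> borel_measurable borel" for n
    by (intro borel_measurable_divide borel_measurable_diff borel_measurable_const) simp_all
qed

text \<open>The features of the two systems that control their velocities, on a common index set. The vector
  \<open>V 0 - V r\<close> is the velocity lost up to time \<open>r\<close>. It is orthogonal to everything that is constant on
  the clusters at time \<open>r\<close>, such as the own positions at that time and all later own velocities, and it is polar to the
  ordered positions of the other system.\<close>

locale interacting_flows =
  fixes P :: "'i set" and w :: "'i \<Rightarrow> real"
    and X1 X2 V1 V2 :: "real \<Rightarrow> 'i \<Rightarrow> real" and C :: "real set"
  assumes finite_index: "finite P" and weight_pos: "p \<in> P \<Longrightarrow> 0 < w p"
    and finite_exceptions: "finite C"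
    and cont1: "p \<in> P \<Longrightarrow> continuous_on {0..} (\<lambda>r. X1 r p)"
    and cont2: "p \<in> P \<Longrightarrow> continuous_on {0..} (\<lambda>r. X2 r p)"
    and right1: "p \<in> P \<Longrightarrow> 0 \<le> r \<Longrightarrow> ((\<lambda>r. X1 r p) has_real_derivative V1 r p) (at_right r)"
    and right2: "p \<in> P \<Longrightarrow> 0 \<le> r \<Longrightarrow> ((\<lambda>r. X2 r p) has_real_derivative V2 r p) (at_right r)"
    and deriv1: "p \<in> P \<Longrightarrow> 0 < r \<Longrightarrow> r \<notin> C \<Longrightarrow> ((\<lambda>r. X1 r p) has_real_derivative V1 r p) (at r)"
    and deriv2: "p \<in> P \<Longrightarrow> 0 < r \<Longrightarrow> r \<notin> C \<Longrightarrow> ((\<lambda>r. X2 r p) has_real_derivative V2 r p) (at r)"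
    and orth_vel1: "0 \<le> r \<Longrightarrow> r \<le> s \<Longrightarrow> wip P w (\<lambda>p. V1 0 p - V1 r p) (V1 s) = 0"
    and orth_vel2: "0 \<le> r \<Longrightarrow> r \<le> s \<Longrightarrow> wip P w (\<lambda>p. V2 0 p - V2 r p) (V2 s) = 0"
    and orth_pos1: "0 \<le> r \<Longrightarrow> wip P w (\<lambda>p. V1 0 p - V1 r p) (X1 r) = 0"
    and orth_pos2: "0 \<le> r \<Longrightarrow> wip P w (\<lambda>p. V2 0 p - V2 r p) (X2 r) = 0"
    and polar12: "0 \<le> r \<Longrightarrow> 0 \<le> s \<Longrightarrow> wip P w (\<lambda>p. V1 0 p - V1 r p) (X2 s) \<le> 0"
    and polar21: "0 \<le> r \<Longrightarrow> 0 \<le> s \<Longrightarrow> wip P w (\<lambda>p. V2 0 p - V2 r p) (X1 s) \<le> 0"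
begin

abbreviation ip :: "('i \<Rightarrow> real) \<Rightarrow> ('i \<Rightarrow> real) \<Rightarrow> real" where "ip \<equiv> wip P w"

definition gap :: "real \<Rightarrow> 'i \<Rightarrow> real" where "gap r p = X1 r p - X2 r p"
definition vgap :: "real \<Rightarrow> 'i \<Rightarrow> real" where "vgap r p = V1 r p - V2 r p"
definition energy :: "real \<Rightarrow> real" where "energy r = ip (V1 r) (V1 r) + ip (V2 r) (V2 r)"
definition dissipation :: "real \<Rightarrow> real" where
  "dissipation r = - ip (\<lambda>p. V1 0 p - V1 r p) (X2 r) - ip (\<lambda>p. V2 0 p - V2 r p) (X1 r)"

lemma ip_nonneg: "0 \<le> ip f f"
  by (rule wip_nonneg[OF weight_pos])

lemma vel_later1: "0 \<le> r \<Longrightarrow> r \<le> s \<Longrightarrow> ip (V1 r) (V1 s) = ip (V1 s) (V1 s)"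
  using orth_vel1[of r s] orth_vel1[of s s] by (simp add: wip_bilinear)

lemma vel_later2: "0 \<le> r \<Longrightarrow> r \<le> s \<Longrightarrow> ip (V2 r) (V2 s) = ip (V2 s) (V2 s)"
  using orth_vel2[of r s] orth_vel2[of s s] by (simp add: wip_bilinear)

text \<open>By the orthogonality of the losses the velocities are successive projections of the initial ones, so
  \<open>\<bar>V r - V s\<bar>^2 = \<bar>V r\<bar>^2 - \<bar>V s\<bar>^2\<close> for \<open>r \<le> s\<close>.\<close>

lemma energy_antimono:
  assumes "0 \<le> r" "r \<le> s"
  shows "energy s \<le> energy r"
  using ip_nonneg[of "\<lambda>p. V1 r p - V1 s p"] ip_nonneg[of "\<lambda>p. V2 r p - V2 s p"]
    vel_later1[OF assms] vel_later2[OF assms]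
  by (simp add: wip_bilinear wip_commute[of P w "V1 s" "V1 r"] wip_commute[of P w "V2 s" "V2 r"] energy_def)

lemma energy_nonneg: "0 \<le> energy r"
  by (simp add: energy_def ip_nonneg)

lemma vgap_le_energy: "ip (vgap r) (vgap r) \<le> 2 * energy r"
  using ip_nonneg[of "\<lambda>p. V1 r p - (- 1) * V2 r p"]
  unfolding vgap_def[abs_def] energy_def wip_bilinear wip_commute[of P w "V2 r" "V1 r"] by simp

text \<open>The decisive pointwise estimate. The identity behind it, for \<open>r = u\<close>, is
  \<open>\<bar>V1 - V2\<bar>^2 = \<langle>V1(0) - V2(0), V1 - V2\<rangle> + \<langle>\<xi>1, V2\<rangle> + \<langle>\<xi>2, V1\<rangle>\<close> with \<open>\<xi> = V(0) - V\<close>. Freezing \<open>\<xi>1\<close> at an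
  earlier time \<open>r\<close> costs \<open>\<langle>V1 r - V1 u, V2 u\<rangle> = \<langle>V1 r - V1 u, V2 u - V1 u\<rangle>\<close>, because \<open>V1 r - V1 u\<close> is
  orthogonal to \<open>V1 u\<close>; half of the left-hand side absorbs one factor, and the square of the
  other one is a drop of energy.\<close>

lemma frozen_loss_estimate:
  assumes "0 \<le> r" "r \<le> u"
  shows "ip (vgap u) (vgap u) / 2 \<le> ip (vgap 0) (vgap u)
     + ip (\<lambda>p. V1 0 p - V1 r p) (V2 u) + ip (\<lambda>p. V2 0 p - V2 r p) (V1 u) + (energy r - energy u)"
proof -
  have u: "0 \<le> u" using assms by simp
  \<comment> \<open>The factor one half makes the cross term \<open>\<langle>V1 r - V1 u, V2 u - V1 u\<rangle>\<close> come with coefficient one.\<close>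
  have 1: "0 \<le> ip (\<lambda>p. (V1 r p - V1 u p) - (1/2) * (V2 u p - V1 u p)) (\<lambda>p. (V1 r p - V1 u p) - (1/2) * (V2 u p - V1 u p))"
    by (rule ip_nonneg)
  have 2: "0 \<le> ip (\<lambda>p. (V2 r p - V2 u p) - (1/2) * (V1 u p - V2 u p)) (\<lambda>p. (V2 r p - V2 u p) - (1/2) * (V1 u p - V2 u p))"
    by (rule ip_nonneg)
  note sym = wip_commute[of P w "V1 u" "V1 r"] wip_commute[of P w "V2 u" "V2 r"]
    wip_commute[of P w "V2 u" "V1 u"] wip_commute[of P w "V2 u" "V1 r"] wip_commute[of P w "V1 u" "V2 r"]
  show ?thesis
    using 1 2 vel_later1[OF assms] vel_later2[OF assms] vel_later1[OF order.refl u] vel_later2[OF order.refl u]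
    unfolding vgap_def[abs_def] energy_def wip_bilinear sym by (simp add: field_simps)
qed

lemma dissipation_eq:
  assumes "0 \<le> r"
  shows "dissipation r = ip (vgap 0) (gap r) - ip (gap r) (vgap r)"
  using orth_pos1[OF assms] orth_pos2[OF assms]
  by (simp add: dissipation_def gap_def[abs_def] vgap_def[abs_def] wip_bilinear
      wip_commute[of P w "X1 r"] wip_commute[of P w "X2 r"])

lemma gap_continuous: "p \<in> P \<Longrightarrow> 0 \<le> a \<Longrightarrow> continuous_on {a..b} (\<lambda>r. gap r p)"
  unfolding gap_def
  by (intro continuous_on_diff continuous_on_subset[OF cont1] continuous_on_subset[OF cont2]) auto

lemma ip_gap_continuous: "0 \<le> a \<Longrightarrow> continuous_on {a..b} (\<lambda>r. ip f (gap r))"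
  unfolding wip_def by (intro continuous_on_sum continuous_on_mult continuous_on_const gap_continuous)

lemma position_integral1:
  assumes "0 \<le> a" "a \<le> b"
  shows "((\<lambda>r. ip f (V1 r)) has_integral ip f (X1 b) - ip f (X1 a)) {a..b}"
  unfolding wip_def
proof (rule fundamental_theorem_of_calculus_interior_strong[OF finite_exceptions assms(2)])
  show "((\<lambda>r. \<Sum>p\<in>P. w p * f p * X1 r p) has_vector_derivative (\<Sum>p\<in>P. w p * f p * V1 r p)) (at r)"
    if "r \<in> {a<..<b} - C" for r
    unfolding has_real_derivative_iff_has_vector_derivative[symmetric]
    using that assms by (intro DERIV_sum DERIV_cmult deriv1) auto
qed (intro continuous_intros continuous_on_subset[OF cont1], use assms in auto)

lemma position_integral2:
  assumes "0 \<le> a" "a \<le> b"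
  shows "((\<lambda>r. ip f (V2 r)) has_integral ip f (X2 b) - ip f (X2 a)) {a..b}"
  unfolding wip_def
proof (rule fundamental_theorem_of_calculus_interior_strong[OF finite_exceptions assms(2)])
  show "((\<lambda>r. \<Sum>p\<in>P. w p * f p * X2 r p) has_vector_derivative (\<Sum>p\<in>P. w p * f p * V2 r p)) (at r)"
    if "r \<in> {a<..<b} - C" for r
    unfolding has_real_derivative_iff_has_vector_derivative[symmetric]
    using that assms by (intro DERIV_sum DERIV_cmult deriv2) auto
qed (intro continuous_intros continuous_on_subset[OF cont2], use assms in auto)

lemma gap_integral:
  assumes "0 \<le> a" "a \<le> b"
  shows "((\<lambda>r. ip f (vgap r)) has_integral ip f (gap b) - ip f (gap a)) {a..b}"
  using has_integral_diff[OF position_integral1[OF assms, of f] position_integral2[OF assms, of f]]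
  by (simp add: vgap_def[abs_def] gap_def[abs_def] wip_bilinear algebra_simps)

lemma gap_square_integral:
  assumes "0 \<le> T"
  shows "((\<lambda>r. ip (gap r) (vgap r)) has_integral ip (gap T) (gap T) / 2 - ip (gap 0) (gap 0) / 2) {0..T}"
proof -
  have eq: "ip (gap r) (gap r) / 2 = (\<Sum>p\<in>P. w p * (gap r p)\<^sup>2 / 2)" for r
    by (simp add: wip_def power2_eq_square sum_divide_distrib mult.assoc)
  show ?thesis
    unfolding eq
  proof (rule fundamental_theorem_of_calculus_interior_strong[OF finite_exceptions assms])
    fix r assume r: "r \<in> {0<..<T} - C"
    have "((\<lambda>r. w p * (gap r p)\<^sup>2 / 2) has_real_derivative w p * gap r p * vgap r p) (at r)" if "p \<in> P" for p
      unfolding gap_def vgap_def using r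
      by (auto intro!: derivative_eq_intros deriv1[OF that] deriv2[OF that])
    then have "((\<lambda>r. \<Sum>p\<in>P. w p * (gap r p)\<^sup>2 / 2) has_real_derivative ip (gap r) (vgap r)) (at r)"
      unfolding wip_def by (intro DERIV_sum)
    then show "((\<lambda>r. \<Sum>p\<in>P. w p * (gap r p)\<^sup>2 / 2) has_vector_derivative ip (gap r) (vgap r)) (at r)"
      by (simp add: has_real_derivative_iff_has_vector_derivative)
  qed (intro continuous_intros gap_continuous, auto)
qed

text \<open>Velocities are right derivatives, hence Borel; time is cut off at \<open>0\<close> because nothing is known about
  negative times.\<close>

lemma velocity_measurable1: "p \<in> P \<Longrightarrow> (\<lambda>r. V1 (max 0 r) p) \<in> borel_measurable borel"
  by (rule right_derivative_measurable[where f="\<lambda>r. X1 r p" and f'="\<lambda>r. V1 r p"], erule cont1, erule (1) right1)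

lemma velocity_measurable2: "p \<in> P \<Longrightarrow> (\<lambda>r. V2 (max 0 r) p) \<in> borel_measurable borel"
  by (rule right_derivative_measurable[where f="\<lambda>r. X2 r p" and f'="\<lambda>r. V2 r p"], erule cont2, erule (1) right2)

lemma energy_integrable: 
  assumes "0 \<le> a" shows "energy integrable_on {a..b}"
proof -
  have "(\<lambda>r. energy (max 0 r)) integrable_on {a..b}"
  proof (rule integrable_bounded_measurable[where B="energy 0"])
    show "(\<lambda>r. energy (max 0 r)) \<in> borel_measurable borel"
      unfolding energy_def wip_def
      by (intro borel_measurable_add borel_measurable_sum borel_measurable_times
          velocity_measurable1 velocity_measurable2 borel_measurable_const)
    show "\<bar>energy (max 0 r)\<bar> \<le> energy 0" for r
      using energy_antimono[of 0 "max 0 r"] energy_nonneg by simp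
  qed
  then show ?thesis by (rule integrable_eq) (use assms in \<open>simp add: max_absorb2\<close>)
qed

lemma vgap_integrable:
  assumes "0 \<le> a" shows "(\<lambda>r. ip (vgap r) (vgap r)) integrable_on {a..b}"
proof -
  have "(\<lambda>r. ip (vgap (max 0 r)) (vgap (max 0 r))) integrable_on {a..b}"
  proof (rule integrable_bounded_measurable[where B="2 * energy 0"])
    show "(\<lambda>r. ip (vgap (max 0 r)) (vgap (max 0 r))) \<in> borel_measurable borel"
      unfolding vgap_def wip_def
      by (intro borel_measurable_diff borel_measurable_sum borel_measurable_times
          velocity_measurable1 velocity_measurable2 borel_measurable_const)
    show "\<bar>ip (vgap (max 0 r)) (vgap (max 0 r))\<bar> \<le> 2 * energy 0" for r
      using energy_antimono[of 0 "max 0 r"] ip_nonneg[of "vgap (max 0 r)"] vgap_le_energy[of "max 0 r"]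
      by simp
  qed
  then show ?thesis by (rule integrable_eq) (use assms in \<open>simp add: max_absorb2\<close>)
qed

text \<open>A primitive of those terms of \<open>frozen_loss_estimate\<close> that depend on \<open>u\<close> only.\<close>

definition potential :: "real \<Rightarrow> real" where
  "potential u = integral {0..u} (\<lambda>r. ip (vgap r) (vgap r)) / 2 - ip (vgap 0) (gap u) + integral {0..u} energy"

text \<open>Integrating \<open>frozen_loss_estimate\<close> over \<open>u \<in> [r, r + h]\<close>: the frozen losses are tested with
  displacements of the other system, and polarity at the later time leaves only the dissipation at
  time \<open>r\<close>.\<close>

lemma potential_increment:
  assumes r: "0 \<le> r" and h: "0 \<le> h"
  shows "potential (r + h) - potential r \<le> dissipation r + h * energy r"
proof -
  let ?D = "\<lambda>u. ip (vgap u) (vgap u)"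
  have rh: "r \<le> r + h" using h by simp
  have split: "integral {0..r + h} f = integral {0..r} f + integral {r..r + h} f"
    if "f integrable_on {0..r + h}" for f :: "real \<Rightarrow> real"
    using Henstock_Kurzweil_Integration.integral_combine[OF r rh that] by simp
  have "((\<lambda>u. ?D u / 2 - ip (vgap 0) (vgap u) + energy u) has_integral
      integral {r..r + h} ?D / 2 - (ip (vgap 0) (gap (r + h)) - ip (vgap 0) (gap r)) + integral {r..r + h} energy) {r..r + h}"
    by (intro has_integral_add has_integral_diff has_integral_divide gap_integral r rh
        integrable_integral energy_integrable vgap_integrable)
  moreover have "potential (r + h) - potential r =
      integral {r..r + h} ?D / 2 - (ip (vgap 0) (gap (r + h)) - ip (vgap 0) (gap r)) + integral {r..r + h} energy"
    unfolding potential_def split[OF energy_integrable[OF order.refl]] split[OF vgap_integrable[OF order.refl]]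
    by (simp add: add_divide_distrib)
  ultimately have lhs: "((\<lambda>u. ?D u / 2 - ip (vgap 0) (vgap u) + energy u) has_integral
      potential (r + h) - potential r) {r..r + h}"
    by simp
  have rhs: "((\<lambda>u. ip (\<lambda>p. V1 0 p - V1 r p) (V2 u) + ip (\<lambda>p. V2 0 p - V2 r p) (V1 u) + energy r) has_integral
      ip (\<lambda>p. V1 0 p - V1 r p) (X2 (r + h)) - ip (\<lambda>p. V1 0 p - V1 r p) (X2 r)
      + (ip (\<lambda>p. V2 0 p - V2 r p) (X1 (r + h)) - ip (\<lambda>p. V2 0 p - V2 r p) (X1 r)) + h * energy r) {r..r + h}"
    using has_integral_const_real[of "energy r" r "r + h"] h
    by (intro has_integral_add position_integral1 position_integral2 r rh) simp
  have "potential (r + h) - potential r \<le> ip (\<lambda>p. V1 0 p - V1 r p) (X2 (r + h)) - ip (\<lambda>p. V1 0 p - V1 r p) (X2 r)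
      + (ip (\<lambda>p. V2 0 p - V2 r p) (X1 (r + h)) - ip (\<lambda>p. V2 0 p - V2 r p) (X1 r)) + h * energy r"
  proof (rule has_integral_le[OF lhs rhs])
    fix u assume "u \<in> {r..r + h}"
    then show "?D u / 2 - ip (vgap 0) (vgap u) + energy u
        \<le> ip (\<lambda>p. V1 0 p - V1 r p) (V2 u) + ip (\<lambda>p. V2 0 p - V2 r p) (V1 u) + energy r"
      using frozen_loss_estimate[OF r, of u] by simp
  qed
  then show ?thesis
    using polar12[OF r, of "r + h"] polar21[OF r, of "r + h"] r h by (simp add: dissipation_def)
qed

lemma potential_continuous: "continuous_on {0..b} potential"
  unfolding potential_def
  by (intro continuous_intros indefinite_integral_continuous_1 ip_gap_continuous
      energy_integrable vgap_integrable) auto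

lemma dissipation_integrable:
  assumes "0 \<le> T" shows "dissipation integrable_on {0..T}"
proof -
  have "(\<lambda>r. ip (vgap 0) (gap r) - ip (gap r) (vgap r)) integrable_on {0..T}"
    by (intro integrable_diff integrable_continuous_real ip_gap_continuous
        has_integral_integrable[OF gap_square_integral] assms) simp
  then show ?thesis by (rule integrable_eq) (simp add: dissipation_eq)
qed

text \<open>By \<open>dissipation_eq\<close> the dissipation is the defect in the growth of the squared distance of the
  positions, so its integral is quadratic in that distance.\<close>

lemma dissipation_bound:
  assumes "0 \<le> T" "0 \<le> a" "0 \<le> d" "ip (vgap 0) (vgap 0) \<le> a\<^sup>2" "T * a \<le> d"
    and gap: "\<And>r. r \<in> {0..T} \<Longrightarrow> ip (gap r) (gap r) \<le> d\<^sup>2"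
  shows "integral {0..T} dissipation \<le> 3 / 2 * d\<^sup>2"
proof -
  have "(dissipation has_integral
      integral {0..T} (\<lambda>r. ip (vgap 0) (gap r)) - (ip (gap T) (gap T) / 2 - ip (gap 0) (gap 0) / 2)) {0..T}"
    by (rule has_integral_eq[OF _ has_integral_diff[OF integrable_integral gap_square_integral]])
       (use assms(1) in \<open>auto simp: dissipation_eq intro!: integrable_continuous_real ip_gap_continuous\<close>)
  then have "integral {0..T} dissipation =
      integral {0..T} (\<lambda>r. ip (vgap 0) (gap r)) - (ip (gap T) (gap T) / 2 - ip (gap 0) (gap 0) / 2)"
    by (rule integral_unique)
  also have "integral {0..T} (\<lambda>r. ip (vgap 0) (gap r)) \<le> integral {0..T} (\<lambda>r. a * d)"
  proof (rule integral_le)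
    fix r assume "r \<in> {0..T}"
    then show "ip (vgap 0) (gap r) \<le> a * d"
      using wip_cauchy_schwarz[OF weight_pos assms(4) gap assms(2,3), of r] by (simp add: abs_le_iff)
  qed (auto intro!: integrable_continuous_real ip_gap_continuous)
  also have "\<dots> = (T * a) * d" using assms(1) by simp
  also have "\<dots> \<le> d * d" using assms(3,5) by (rule mult_right_mono[rotated])
  finally have "integral {0..T} dissipation \<le> d * d - (ip (gap T) (gap T) / 2 - ip (gap 0) (gap 0) / 2)" by simp
  then show ?thesis
    using ip_nonneg[of "gap T"] gap[of 0] assms(1) by (simp add: power2_eq_square)
qed

text \<open>Integrating once more over \<open>r \<in> [0, T]\<close> telescopes the increments of the potential into its averages
  over \<open>[T, T + h]\<close> and over \<open>[0, h]\<close>. The energy accumulated over \<open>[0, T]\<close> occurs on both sides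
  and cancels, and \<open>h\<close> remains free: it balances the dissipation, quadratic in the distance of the
  positions, against the energy.\<close>

theorem velocity_gap_bound:
  assumes T: "0 \<le> T" and h: "0 < h" and a: "0 \<le> a" and d: "0 \<le> d"
    and vgap0: "ip (vgap 0) (vgap 0) \<le> a\<^sup>2" and Ta: "T * a \<le> d"
    and gap: "\<And>r. r \<in> {0..T + h} \<Longrightarrow> ip (gap r) (gap r) \<le> d\<^sup>2"
  shows "integral {0..T} (\<lambda>r. ip (vgap r) (vgap r)) \<le> 4 * a * d + 4 * h * energy 0 + 3 * d\<^sup>2 / h"
proof -
  let ?D = "\<lambda>r. ip (vgap r) (vgap r)"
  define DD where "DD u = integral {0..u} ?D" for u
  define EE where "EE u = integral {0..u} energy" for u
  have pot: "potential u = DD u / 2 - ip (vgap 0) (gap u) + EE u" for u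
    by (simp add: potential_def DD_def EE_def)
  have DD_mono: "DD s \<le> DD u" if "0 \<le> s" "s \<le> u" for s u
    unfolding DD_def using that
    by (intro integral_subset_le vgap_integrable ballI ip_nonneg) auto
  have EE_mono: "EE s \<le> EE u" if "0 \<le> s" "s \<le> u" for s u
    unfolding EE_def using that
    by (intro integral_subset_le energy_integrable ballI energy_nonneg) auto
  have "DD h \<le> integral {0..h} (\<lambda>r. 2 * energy r)"
    unfolding DD_def
    by (rule integral_le[OF vgap_integrable integrable_on_mult_right[OF energy_integrable] vgap_le_energy]) auto
  then have DD_EE: "DD h \<le> 2 * EE h"
    by (simp add: EE_def)
  have "EE h \<le> integral {0..h} (\<lambda>_. energy 0)"
    unfolding EE_def by (intro integral_le energy_integrable energy_antimono) auto
  then have EE_h: "EE h \<le> h * energy 0" using h by simp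
  have cross: "\<bar>ip (vgap 0) (gap u)\<bar> \<le> a * d" if "u \<in> {0..T + h}" for u
    by (rule wip_cauchy_schwarz[OF weight_pos vgap0 gap[OF that] a d])
  have pot_int: "potential integrable_on {s..u}" if "0 \<le> s" for s u
    using continuous_on_subset[OF potential_continuous[of u]] that by (intro integrable_continuous_real) auto
  have shift: "integral {0..T} (\<lambda>r. potential (r + h)) = integral {h..T + h} potential"
    using integral_shift_Icc_real[of 0 T potential h] by (simp add: o_def add.commute)
  have shift_int: "(\<lambda>r. potential (r + h)) integrable_on {0..T}"
    by (intro integrable_continuous_real continuous_on_compose2[OF potential_continuous[of "T + h"]] continuous_intros)
       (use h in auto)
  have "integral {0..h} potential + integral {h..T + h} potential = integral {0..T + h} potential"
    "integral {0..T} potential + integral {T..T + h} potential = integral {0..T + h} potential"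
    using T h by (auto intro!: Henstock_Kurzweil_Integration.integral_combine pot_int)
  then have "integral {T..T + h} potential - integral {0..h} potential
      = integral {0..T} (\<lambda>r. potential (r + h)) - integral {0..T} potential"
    unfolding shift by linarith
  also have "\<dots> = integral {0..T} (\<lambda>r. potential (r + h) - potential r)"
    by (rule integral_diff[symmetric, OF shift_int pot_int]) simp
  also have "\<dots> \<le> integral {0..T} (\<lambda>r. dissipation r + h * energy r)"
    using h potential_increment
    by (intro integral_le integrable_diff shift_int pot_int
        integrable_add[OF dissipation_integrable[OF T] integrable_on_mult_right[OF energy_integrable]]) auto
  also have "\<dots> = integral {0..T} dissipation + h * EE T"
    unfolding EE_def
    by (simp add: integral_add[OF dissipation_integrable[OF T] integrable_on_mult_right[OF energy_integrable]])
  also have "integral {0..T} dissipation \<le> 3 / 2 * d\<^sup>2"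
    using gap h by (intro dissipation_bound[OF T a d vgap0 Ta]) auto
  finally have up: "integral {T..T + h} potential - integral {0..h} potential \<le> 3 / 2 * d\<^sup>2 + h * EE T" by simp
  have "integral {T..T + h} (\<lambda>_. DD T / 2 - a * d + EE T) \<le> integral {T..T + h} potential"
  proof (rule integral_le)
    fix u assume u: "u \<in> {T..T + h}"
    then show "DD T / 2 - a * d + EE T \<le> potential u"
      using DD_mono[of T u] EE_mono[of T u] cross[of u] T by (simp add: pot abs_le_iff)
  qed (use T pot_int in auto)
  then have low: "h * (DD T / 2 - a * d + EE T) \<le> integral {T..T + h} potential" using h by simp
  have "integral {0..h} potential \<le> integral {0..h} (\<lambda>_. DD h / 2 + a * d + EE h)"
  proof (rule integral_le)
    fix u assume u: "u \<in> {0..h}"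
    then show "potential u \<le> DD h / 2 + a * d + EE h"
      using DD_mono[of u h] EE_mono[of u h] cross[of u] T by (simp add: pot abs_le_iff)
  qed (use T pot_int in auto)
  then have "integral {0..h} potential \<le> h * (DD h / 2 + a * d + EE h)" using h by simp
  also have "\<dots> \<le> h * (a * d + 2 * (h * energy 0))"
    using DD_EE EE_h h by (intro mult_left_mono) auto
  finally have "h * (DD T / 2) \<le> 2 * (h * (a * d)) + 2 * h * (h * energy 0) + 3 / 2 * d\<^sup>2"
    using up low by (simp add: algebra_simps)
  then have "h * DD T \<le> h * (4 * a * d + 4 * h * energy 0 + 3 * d\<^sup>2 / h)"
    using h by (simp add: algebra_simps)
  then show ?thesis using h by (simp add: DD_def)
qed

end

section \<open>Discrete measures and their rearrangements\<close>

lemma borel_measurable_restrict_finite: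
  assumes "finite S" "\<And>s. s \<in> S \<Longrightarrow> {s} \<in> sets M"
  shows "(\<lambda>x. f x * indicator S x :: ennreal) \<in> borel_measurable M"
    and "(\<lambda>x. h x * indicator S x :: real) \<in> borel_measurable M"
proof -
  have f: "(\<lambda>x. f x * indicator S x) = (\<lambda>x. \<Sum>s\<in>S. f s * indicator {s} x)"
    using assms(1) by (auto simp: fun_eq_iff indicator_def if_distrib sum.delta' cong: if_cong)
  show "(\<lambda>x. f x * indicator S x) \<in> borel_measurable M"
    unfolding f by (intro borel_measurable_sum borel_measurable_times_ennreal borel_measurable_const
        borel_measurable_indicator assms)
  have h: "(\<lambda>x. h x * indicator S x) = (\<lambda>x. \<Sum>s\<in>S. h s * indicator {s} x)"
    using assms(1) by (auto simp: fun_eq_iff indicator_def if_distrib sum.delta' cong: if_cong)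
  show "(\<lambda>x. h x * indicator S x) \<in> borel_measurable M"
    unfolding h by (intro borel_measurable_sum borel_measurable_times borel_measurable_const
        borel_measurable_indicator assms)
qed

text \<open>The measure is carried by a finite set, on which every function is simple; so \<open>f\<close> may be an
  arbitrary convex cost composed with an arbitrary choice of densities.\<close>

lemma nn_integral_distr_point_measure:
  assumes A: "finite A" and k: "k \<in> A \<rightarrow> space M" and single: "\<And>a. a \<in> A \<Longrightarrow> {k a} \<in> sets M"
  shows "(\<integral>\<^sup>+x. f x \<partial>distr (point_measure A w) M k) = (\<Sum>a\<in>A. w a * f (k a))"
proof -
  let ?D = "distr (point_measure A w) M k" and ?S = "k ` A"
  have meas: "k \<in> point_measure A w \<rightarrow>\<^sub>M M"
    using k by (simp add: measurable_point_measure_eq1)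
  have S: "?S \<in> sets M"
    using sets.finite_UN[of A "\<lambda>a. {k a}" M] A single by (simp add: UNION_singleton_eq_range)
  have "AE x in ?D. x \<in> ?S"
    by (subst AE_distr_iff[OF meas]) (use S in \<open>auto simp: AE_point_measure\<close>)
  then have "(\<integral>\<^sup>+x. f x \<partial>?D) = (\<integral>\<^sup>+x. f x * indicator ?S x \<partial>?D)"
    by (intro nn_integral_cong_AE) (auto simp: indicator_def)
  also have "\<dots> = (\<integral>\<^sup>+a. f (k a) * indicator ?S (k a) \<partial>point_measure A w)"
    using A single by (intro nn_integral_distr meas) (auto intro!: borel_measurable_restrict_finite)
  also have "\<dots> = (\<Sum>a\<in>A. w a * f (k a))"
    using A by (simp add: nn_integral_point_measure_finite)
  finally show ?thesis .
qed

locale mass_distribution =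
  fixes N :: nat and m :: "nat \<Rightarrow> real"
  assumes m_pos: "i < N \<Longrightarrow> 0 < m i" and m_sum: "(\<Sum>i<N. m i) = 1"

lemma (in sticky_particles) mass_distribution: "mass_distribution N m"
  using mass_pos mass_sum by unfold_locales

lemma nn_integral_discrete_measure:
  "(\<integral>\<^sup>+y. f y \<partial>discrete_measure N m x) = (\<Sum>i<N. ennreal (m i) * f (x i))"
  unfolding discrete_measure_def by (rule nn_integral_distr_point_measure) auto

lemma emeasure_discrete_measure:
  "A \<in> sets borel \<Longrightarrow> emeasure (discrete_measure N m x) A = (\<Sum>i<N. ennreal (m i) * indicator A (x i))"
  by (subst nn_integral_discrete_measure[symmetric]) (simp add: discrete_measure_def)

lemma AE_discrete_measure: "AE y in discrete_measure N m x. y \<in> x ` {..<N}"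
  unfolding discrete_measure_def
  by (subst AE_distr_iff) (auto simp: AE_point_measure measurable_point_measure_eq1 intro!: borel_closed finite_imp_closed)

context mass_distribution
begin

lemma m_nonneg: "i \<in> {..<N} \<Longrightarrow> 0 \<le> m i"
  using m_pos by (simp add: less_imp_le)

lemma measure_discrete_measure:
  assumes "A \<in> sets borel"
  shows "measure (discrete_measure N m x) A = (\<Sum>i<N. m i * indicator A (x i))"
proof -
  have "emeasure (discrete_measure N m x) A = (\<Sum>i<N. ennreal (m i * indicator A (x i)))"
    unfolding emeasure_discrete_measure[OF assms] by (intro sum.cong) (auto simp: indicator_def)
  also have "\<dots> = ennreal (\<Sum>i<N. m i * indicator A (x i))"
    by (intro sum_ennreal mult_nonneg_nonneg m_nonneg) auto
  finally show ?thesis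
    by (rule measure_eq_emeasure_eq_ennreal[rotated]) (intro sum_nonneg mult_nonneg_nonneg m_nonneg, auto)
qed

text \<open>The index of the particle that occupies the quantile \<open>w\<close>; it depends on the masses only, so all
  the rearrangements that occur are functions of two such indices.\<close>

definition quantile_index :: "real \<Rightarrow> nat" where
  "quantile_index w = (LEAST i. w < (\<Sum>k\<le>i. m k))"

lemma quantile_index_less:
  assumes "w < 1" shows "quantile_index w < N" "w < (\<Sum>k\<le>quantile_index w. m k)"
proof -
  obtain n where n: "N = Suc n" using m_sum by (cases N) auto
  have ex: "w < (\<Sum>k\<le>n. m k)" using assms m_sum n by (simp add: lessThan_Suc_atMost)
  then have "quantile_index w \<le> n" unfolding quantile_index_def by (rule Least_le)
  then show "quantile_index w < N" using n by simp
  show "w < (\<Sum>k\<le>quantile_index w. m k)" unfolding quantile_index_def using ex by (rule LeastI)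
qed

lemma quantile_index_ge:
  assumes "0 < w" "w < 1" shows "(\<Sum>k<quantile_index w. m k) \<le> w"
proof (cases "quantile_index w")
  case (Suc i)
  then have "\<not> w < (\<Sum>k\<le>i. m k)"
    unfolding quantile_index_def by (intro not_less_Least) simp
  then show ?thesis using Suc by (simp add: lessThan_Suc_atMost)
qed (use assms in simp)

lemma quantile_index_eq_iff:
  assumes w: "0 < w" "w < 1" and i: "i < N"
  shows "quantile_index w = i \<longleftrightarrow> w \<in> {(\<Sum>k<i. m k)..<(\<Sum>k\<le>i. m k)}"
proof
  assume "w \<in> {(\<Sum>k<i. m k)..<(\<Sum>k\<le>i. m k)}"
  then show "quantile_index w = i"
    unfolding quantile_index_def
  proof (intro Least_equality)
    fix j assume j: "w < (\<Sum>k\<le>j. m k)"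
    show "i \<le> j"
    proof (rule ccontr)
      assume "\<not> i \<le> j"
      then have "(\<Sum>k\<le>j. m k) \<le> (\<Sum>k<i. m k)" using i m_nonneg by (intro sum_mono2) auto
      then show False using j \<open>w \<in> _\<close> by auto
    qed
  qed auto
qed (use quantile_index_less quantile_index_ge w in auto)

lemma quantile_index_mono:
  assumes "0 < w" "w \<le> w'" "w' < 1" shows "quantile_index w \<le> quantile_index w'"
  unfolding quantile_index_def[of w] using quantile_index_less[OF assms(3)] assms(2) by (intro Least_le) auto

lemma rearrangement_discrete_measure:
  assumes w: "0 < w" "w < 1" and x: "mono_on {..<N} x"
  shows "rearrangement (discrete_measure N m x) w = x (quantile_index w)"
  unfolding rearrangement_def
proof (rule cInf_eq_minimum)
  let ?i = "quantile_index w"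
  have cdf: "cdf (discrete_measure N m x) y = (\<Sum>k<N. m k * indicator {..y} (x k))" for y
    by (simp add: cdf_def measure_discrete_measure)
  note i = quantile_index_less[OF w(2)]
  have x_le: "x i \<le> x j" if "i \<le> j" "j < N" for i j
    using mono_onD[OF x, of i j] that by simp
  have "(\<Sum>k\<le>?i. m k) = (\<Sum>k\<le>?i. m k * indicator {..x ?i} (x k))"
    using x_le i by (intro sum.cong) auto
  also have "\<dots> \<le> (\<Sum>k<N. m k * indicator {..x ?i} (x k))"
    using i m_nonneg by (intro sum_mono2) auto
  finally show "x ?i \<in> {y. w < cdf (discrete_measure N m x) y}"
    using i(2) by (simp add: cdf)
  fix y assume "y \<in> {y. w < cdf (discrete_measure N m x) y}"
  then have y: "w < (\<Sum>k<N. m k * indicator {..y} (x k))" by (simp add: cdf)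
  show "x ?i \<le> y"
  proof (rule ccontr)
    assume "\<not> x ?i \<le> y"
    then have "indicator {..y} (x k) = (0::real)" if "?i \<le> k" "k < N" for k
      using x_le[OF that] by (simp add: indicator_def)
    then have "(\<Sum>k<N. m k * indicator {..y} (x k)) = (\<Sum>k<?i. m k * indicator {..y} (x k))"
      using i(1) by (intro sum.mono_neutral_right) (auto simp: not_less)
    also have "\<dots> \<le> (\<Sum>k<?i. m k)"
      using i(1) m_nonneg by (intro sum_mono) (auto simp: indicator_def)
    finally show False using y quantile_index_ge[OF w] by simp
  qed
qed

lemma sets_quantile_index:
  assumes "i < N"
  shows "{w \<in> {0<..<1}. quantile_index w = i} = {(\<Sum>k<i. m k)..<(\<Sum>k\<le>i. m k)} - {0}"
proof -
  have "(\<Sum>k\<le>i. m k) \<le> (\<Sum>k<N. m k)" using assms m_nonneg by (intro sum_mono2) auto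
  moreover have "0 \<le> (\<Sum>k<i. m k)" using assms m_nonneg by (intro sum_nonneg) auto
  ultimately show ?thesis
    using quantile_index_eq_iff[OF _ _ assms] m_sum by force
qed

lemma quantile_index_measurable:
  "quantile_index \<in> restrict_space lborel {0<..<1} \<rightarrow>\<^sub>M count_space {..<N}"
proof -
  have "quantile_index -` {i} \<inter> {0<..<1} \<in> sets (restrict_space lborel {0<..<1})" if "i < N" for i
  proof -
    have "quantile_index -` {i} \<inter> {0<..<1} = {w \<in> {0<..<1}. quantile_index w = i}" by auto
    then show ?thesis
      using sets_quantile_index[OF that] by (auto simp: sets_restrict_space_iff)
  qed
  then show ?thesis
    by (auto simp: measurable_count_space_eq2 space_restrict_space quantile_index_less)
qed

lemma distr_quantile_index:
  "distr (restrict_space lborel {0<..<1}) (count_space {..<N}) quantile_index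
     = point_measure {..<N} (\<lambda>i. ennreal (m i))"
proof (rule measure_eqI_finite[where A="{..<N}"])
  fix i assume "i \<in> {..<N}"
  then have i: "i < N" by simp
  have "emeasure (distr (restrict_space lborel {0<..<1}) (count_space {..<N}) quantile_index) {i}
      = emeasure lborel {w \<in> {0<..<1}. quantile_index w = i}"
    using i quantile_index_measurable
    by (subst emeasure_distr)
       (auto simp: space_restrict_space emeasure_restrict_space intro!: arg_cong[where f="emeasure lborel"])
  also have "\<dots> = emeasure lborel {(\<Sum>k<i. m k)..<(\<Sum>k\<le>i. m k)}"
    unfolding sets_quantile_index[OF i]
    by (intro emeasure_Diff_null_set) (auto intro: countable_imp_null_set_lborel)
  also have "\<dots> = ennreal (m i)"
    using m_pos[OF i] by (simp add: lessThan_Suc_atMost[symmetric])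
  finally show "emeasure (distr (restrict_space lborel {0<..<1}) (count_space {..<N}) quantile_index) {i}
      = emeasure (point_measure {..<N} (\<lambda>i. ennreal (m i))) {i}"
    using i by (simp add: emeasure_point_measure_finite)
qed (auto simp: sets_point_measure)

text \<open>The density is recovered by evaluating the signed measure at single points.\<close>

lemma velocity_discrete_datum:
  assumes i: "i < N" and v: "\<And>i j. i < N \<Longrightarrow> j < N \<Longrightarrow> x i = x j \<Longrightarrow> v i = v j"
  shows "velocity (discrete_datum N m x v) (x i) = v i"
proof -
  let ?\<rho> = "discrete_measure N m x"
  have meas: "x \<in> point_measure {..<N} (\<lambda>i. ennreal (m i)) \<rightarrow>\<^sub>M borel"
    by (simp add: measurable_point_measure_eq1)
  have int: "(LINT y:A|?\<rho>. u y) = (\<Sum>k<N. m k * (indicator A (x k) * u (x k)))"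
    if "u \<in> borel_measurable borel" "A \<in> sets borel" for u A
    using that m_nonneg unfolding set_lebesgue_integral_def discrete_measure_def
    by (subst integral_distr[OF meas], measurable) (subst lebesgue_integral_point_measure_finite, auto)
  define P where "P u \<longleftrightarrow> u \<in> borel_measurable borel \<and> integrable ?\<rho> u \<and>
     (\<forall>A\<in>sets borel. (\<Sum>i<N. m i * v i * indicator A (x i)) = (LINT y:A|?\<rho>. u y))" for u
  define u0 where "u0 y = v (SOME k. k < N \<and> x k = y) * indicator (x ` {..<N}) y" for y
  have u0: "u0 (x k) = v k" if "k < N" for k
  proof -
    have "(SOME j. j < N \<and> x j = x k) < N \<and> x (SOME j. j < N \<and> x j = x k) = x k"
      by (rule someI[of _ k]) (use that in simp)
    then show ?thesis using v[of "SOME j. j < N \<and> x j = x k" k] that by (simp add: u0_def)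
  qed
  have u0_meas: "u0 \<in> borel_measurable borel"
    unfolding u0_def by (intro borel_measurable_restrict_finite) auto
  have u0_eq: "(\<Sum>i<N. m i * v i * indicator A (x i)) = (LINT y:A|?\<rho>. u0 y)" if "A \<in> sets borel" for A
    unfolding int[OF u0_meas that] by (intro sum.cong refl) (simp add: u0)
  have "integrable ?\<rho> u0"
    unfolding discrete_measure_def using u0_meas
    by (subst integrable_distr_eq[OF meas]) (auto intro!: integrable_point_measure_finite)
  then have "P u0"
    unfolding P_def using u0_meas u0_eq by (intro conjI ballI)
  then have "P (SOME u. P u)" by (rule someI[of P])
  moreover have "velocity (discrete_datum N m x v) = (SOME u. P u)"
    by (simp add: velocity_def discrete_datum_def P_def)
  ultimately have "P (velocity (discrete_datum N m x v))" by simp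
  then have vel: "velocity (discrete_datum N m x v) \<in> borel_measurable borel"
    and vel_eq: "\<forall>A\<in>sets borel. (\<Sum>i<N. m i * v i * indicator A (x i))
      = (LINT y:A|?\<rho>. velocity (discrete_datum N m x v) y)"
    unfolding P_def by - (elim conjE, assumption)+
  have single: "{x i} \<in> sets borel" by simp
  have "(\<Sum>k<N. m k * v k * indicator {x i} (x k))
      = (\<Sum>k<N. m k * (indicator {x i} (x k) * velocity (discrete_datum N m x v) (x k)))"
    using bspec[OF vel_eq single] int[OF vel single] by (rule trans)
  also have "(\<Sum>k<N. m k * v k * indicator {x i} (x k)) = (\<Sum>k<N. m k * indicator {x i} (x k)) * v i"
    unfolding sum_distrib_right using v[OF _ i] by (intro sum.cong) (auto simp: indicator_def)
  also have "(\<Sum>k<N. m k * (indicator {x i} (x k) * velocity (discrete_datum N m x v) (x k)))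
      = (\<Sum>k<N. m k * indicator {x i} (x k)) * velocity (discrete_datum N m x v) (x i)"
    unfolding sum_distrib_right by (intro sum.cong) (auto simp: indicator_def)
  finally have "(\<Sum>k<N. m k * indicator {x i} (x k)) * v i
      = (\<Sum>k<N. m k * indicator {x i} (x k)) * velocity (discrete_datum N m x v) (x i)" .
  moreover have "0 < (\<Sum>k<N. m k * indicator {x i} (x k))"
    using i m_pos m_nonneg by (intro sum_pos2[of _ i]) auto
  ultimately show ?thesis by simp
qed

end

section \<open>The monotone coupling of discrete measures\<close>

lemma singleton_sets_borel_pair: "{q} \<in> sets (borel \<Otimes>\<^sub>M borel :: (real \<times> real) measure)"
  unfolding borel_prod by simp

locale mass_pair = M1: mass_distribution N1 m1 + M2: mass_distribution N2 m2
  for N1 m1 N2 m2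
begin

definition pair_index :: "real \<Rightarrow> nat \<times> nat" where
  "pair_index w = (M1.quantile_index w, M2.quantile_index w)"

definition pair_weight :: "nat \<times> nat \<Rightarrow> real" where
  "pair_weight p = measure lborel {w \<in> {0<..<1}. pair_index w = p}"

definition pair_support :: "(nat \<times> nat) set" where
  "pair_support = {p \<in> {..<N1} \<times> {..<N2}. 0 < pair_weight p}"

lemma pair_index_measurable:
  "pair_index \<in> restrict_space lborel {0<..<1} \<rightarrow>\<^sub>M count_space ({..<N1} \<times> {..<N2})"
proof -
  have "pair_index \<in> restrict_space lborel {0<..<1} \<rightarrow>\<^sub>M count_space {..<N1} \<Otimes>\<^sub>M count_space {..<N2}"
    unfolding pair_index_def by (intro measurable_Pair M1.quantile_index_measurable M2.quantile_index_measurable)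
  then show ?thesis by (simp add: pair_measure_countable)
qed

lemma distr_pair_index:
  "distr (restrict_space lborel {0<..<1}) (count_space ({..<N1} \<times> {..<N2})) pair_index
     = point_measure ({..<N1} \<times> {..<N2}) (\<lambda>p. ennreal (pair_weight p))"
proof (rule measure_eqI_finite[where A="{..<N1} \<times> {..<N2}"])
  fix p assume p: "p \<in> {..<N1} \<times> {..<N2}"
  have "emeasure (distr (restrict_space lborel {0<..<1}) (count_space ({..<N1} \<times> {..<N2})) pair_index) {p}
      = emeasure lborel {w \<in> {0<..<1}. pair_index w = p}"
    using p pair_index_measurable
    by (subst emeasure_distr)
       (auto simp: space_restrict_space emeasure_restrict_space intro!: arg_cong[where f="emeasure lborel"])
  also have "\<dots> = ennreal (pair_weight p)"
    unfolding pair_weight_def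
  proof (rule emeasure_eq_ennreal_measure)
    have "emeasure lborel {w \<in> {0<..<1}. pair_index w = p} \<le> emeasure lborel {0<..<1::real}"
      by (intro emeasure_mono) auto
    then show "emeasure lborel {w \<in> {0<..<1}. pair_index w = p} \<noteq> top"
      by (auto simp: top_unique)
  qed
  finally show "emeasure (distr (restrict_space lborel {0<..<1}) (count_space ({..<N1} \<times> {..<N2})) pair_index) {p}
      = emeasure (point_measure ({..<N1} \<times> {..<N2}) (\<lambda>p. ennreal (pair_weight p))) {p}"
    using p by (simp add: emeasure_point_measure_finite)
qed (auto simp: sets_point_measure)

lemma pair_weight_nonneg: "0 \<le> pair_weight p"
  by (simp add: pair_weight_def)

text \<open>The marginals are read off by projecting the image of Lebesgue measure under \<open>pair_index\<close>.\<close>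

lemma pair_marginal:
  fixes k :: "nat \<times> nat \<Rightarrow> nat"
  assumes k: "k \<in> {..<N1} \<times> {..<N2} \<rightarrow> {..<n}" and i: "i < n"
    and eq: "distr (restrict_space lborel {0<..<1}) (count_space {..<n}) (k \<circ> pair_index)
      = point_measure {..<n} (\<lambda>i. ennreal (m i))" and m: "0 \<le> m i"
  shows "(\<Sum>p\<in>{p\<in>pair_support. k p = i}. pair_weight p) = m i"
proof -
  let ?Q = "{..<N1} \<times> {..<N2}"
  have "ennreal (m i) = emeasure (distr (restrict_space lborel {0<..<1}) (count_space {..<n}) (k \<circ> pair_index)) {i}"
    using i by (simp add: eq emeasure_point_measure_finite)
  also have "\<dots> = emeasure (distr (point_measure ?Q (\<lambda>p. ennreal (pair_weight p))) (count_space {..<n}) k) {i}"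
    unfolding distr_pair_index[symmetric] using k
    by (subst distr_distr[OF _ pair_index_measurable]) auto
  also have "\<dots> = emeasure (point_measure ?Q (\<lambda>p. ennreal (pair_weight p))) {p\<in>?Q. k p = i}"
    using k i by (subst emeasure_distr)
      (auto simp: measurable_point_measure_eq1 space_point_measure intro!: arg_cong2[where f=emeasure])
  also have "\<dots> = (\<Sum>p\<in>{p\<in>?Q. k p = i}. ennreal (pair_weight p))"
    by (subst emeasure_point_measure_finite) auto
  also have "\<dots> = ennreal (\<Sum>p\<in>{p\<in>?Q. k p = i}. pair_weight p)"
    by (intro sum_ennreal pair_weight_nonneg)
  also have "(\<Sum>p\<in>{p\<in>?Q. k p = i}. pair_weight p) = (\<Sum>p\<in>{p\<in>pair_support. k p = i}. pair_weight p)"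
    using pair_weight_nonneg
    by (intro sum.mono_neutral_right) (auto simp: pair_support_def less_le)
  finally show ?thesis using m pair_weight_nonneg by (simp add: sum_nonneg)
qed

sublocale comonotone_coupling N1 N2 m1 m2 pair_support pair_weight
proof
  show "pair_support \<subseteq> {..<N1} \<times> {..<N2}" "\<And>p. p \<in> pair_support \<Longrightarrow> 0 < pair_weight p"
    by (auto simp: pair_support_def)
  show "(\<Sum>p\<in>{p\<in>pair_support. fst p = i}. pair_weight p) = m1 i" if "i < N1" for i
    using that M1.distr_quantile_index M1.m_pos[OF that]
    by (intro pair_marginal[where n=N1]) (auto simp: pair_index_def comp_def)
  show "(\<Sum>p\<in>{p\<in>pair_support. snd p = j}. pair_weight p) = m2 j" if "j < N2" for j
    using that M2.distr_quantile_index M2.m_pos[OF that]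
    by (intro pair_marginal[where n=N2]) (auto simp: pair_index_def comp_def)
  fix p q assume pq: "p \<in> pair_support" "q \<in> pair_support" "fst p < fst q"
  have "\<exists>w\<in>{0<..<1}. pair_index w = r" if "r \<in> pair_support" for r
  proof (rule ccontr)
    assume "\<not> (\<exists>w\<in>{0<..<1}. pair_index w = r)"
    then have "{w \<in> {0<..<1}. pair_index w = r} = {}" by auto
    then have "pair_weight r = 0" by (simp only: pair_weight_def) simp
    then show False using that by (simp add: pair_support_def)
  qed
  then obtain w w' where w: "w \<in> {0<..<1}" "pair_index w = p" "w' \<in> {0<..<1}" "pair_index w' = q"
    using pq by meson
  have "w \<le> w'"
    using M1.quantile_index_mono[of w' w] w pq(3) by (fastforce simp: pair_index_def)
  then show "snd p \<le> snd q"
    using M2.quantile_index_mono[of w w'] w by (auto simp: pair_index_def)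
qed

lemma optimal_coupling_discrete:
  assumes x: "mono_on {..<N1} x" and y: "mono_on {..<N2} y"
  shows "optimal_coupling (discrete_measure N1 m1 x) (discrete_measure N2 m2 y)
     = distr (point_measure ({..<N1} \<times> {..<N2}) (\<lambda>p. ennreal (pair_weight p))) (borel \<Otimes>\<^sub>M borel)
         (\<lambda>p. (x (fst p), y (snd p)))"
proof -
  have "optimal_coupling (discrete_measure N1 m1 x) (discrete_measure N2 m2 y)
     = distr (restrict_space lborel {0<..<1}) (borel \<Otimes>\<^sub>M borel) ((\<lambda>p. (x (fst p), y (snd p))) \<circ> pair_index)"
    unfolding optimal_coupling_def
    using x y by (intro distr_cong)
      (auto simp: space_restrict_space M1.rearrangement_discrete_measure M2.rearrangement_discrete_measure pair_index_def)
  also have "\<dots> = distr (distr (restrict_space lborel {0<..<1}) (count_space ({..<N1} \<times> {..<N2})) pair_index)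
      (borel \<Otimes>\<^sub>M borel) (\<lambda>p. (x (fst p), y (snd p)))"
    by (rule distr_distr[symmetric, OF _ pair_index_measurable]) (auto simp: space_pair_measure)
  finally show ?thesis unfolding distr_pair_index .
qed

lemma nn_integral_optimal_coupling:
  assumes x: "mono_on {..<N1} x" and y: "mono_on {..<N2} y"
  shows "(\<integral>\<^sup>+q. f q \<partial>optimal_coupling (discrete_measure N1 m1 x) (discrete_measure N2 m2 y))
     = (\<Sum>p\<in>pair_support. ennreal (pair_weight p) * f (x (fst p), y (snd p)))"
proof -
  have "(\<integral>\<^sup>+q. f q \<partial>optimal_coupling (discrete_measure N1 m1 x) (discrete_measure N2 m2 y))
     = (\<Sum>p\<in>{..<N1} \<times> {..<N2}. ennreal (pair_weight p) * f (x (fst p), y (snd p)))"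
    unfolding optimal_coupling_discrete[OF x y]
    by (rule nn_integral_distr_point_measure) (auto simp: space_pair_measure singleton_sets_borel_pair)
  also have "\<dots> = (\<Sum>p\<in>pair_support. ennreal (pair_weight p) * f (x (fst p), y (snd p)))"
    by (rule sum.mono_neutral_right) (auto simp: pair_support_def ennreal_neg not_less)
  finally show ?thesis .
qed

lemma optimal_coupling_in_couplings:
  assumes x: "mono_on {..<N1} x" and y: "mono_on {..<N2} y"
  shows "optimal_coupling (discrete_measure N1 m1 x) (discrete_measure N2 m2 y)
     \<in> couplings (discrete_measure N1 m1 x) (discrete_measure N2 m2 y)"
proof -
  let ?L = "restrict_space lborel {0<..<1::real}" and ?Q = "count_space ({..<N1} \<times> {..<N2})"
  let ?h = "\<lambda>p. (x (fst p), y (snd p))"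
  have h: "?h \<in> ?Q \<rightarrow>\<^sub>M borel \<Otimes>\<^sub>M borel" by (auto simp: space_pair_measure)
  have opt: "optimal_coupling (discrete_measure N1 m1 x) (discrete_measure N2 m2 y)
      = distr ?L (borel \<Otimes>\<^sub>M borel) (?h \<circ> pair_index)"
    unfolding optimal_coupling_discrete[OF x y] distr_pair_index[symmetric]
    by (rule distr_distr[OF h pair_index_measurable])
  have hp: "?h \<circ> pair_index \<in> ?L \<rightarrow>\<^sub>M borel \<Otimes>\<^sub>M borel"
    by (rule measurable_comp[OF pair_index_measurable h])
  have L: "prob_space ?L"
    by (rule prob_spaceI) (simp add: space_restrict_space emeasure_restrict_space)
  have 1: "discrete_measure N1 m1 x = distr ?L borel (x \<circ> M1.quantile_index)"
    unfolding discrete_measure_def M1.distr_quantile_index[symmetric]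
    by (rule distr_distr[OF _ M1.quantile_index_measurable]) simp
  have 2: "discrete_measure N2 m2 y = distr ?L borel (y \<circ> M2.quantile_index)"
    unfolding discrete_measure_def M2.distr_quantile_index[symmetric]
    by (rule distr_distr[OF _ M2.quantile_index_measurable]) simp
  have "distr (distr ?L (borel \<Otimes>\<^sub>M borel) (?h \<circ> pair_index)) borel fst = discrete_measure N1 m1 x"
    by (subst distr_distr[OF measurable_fst hp]) (simp add: 1 comp_def pair_index_def)
  moreover have "distr (distr ?L (borel \<Otimes>\<^sub>M borel) (?h \<circ> pair_index)) borel snd = discrete_measure N2 m2 y"
    by (subst distr_distr[OF measurable_snd hp]) (simp add: 2 comp_def pair_index_def)
  ultimately show ?thesis
    unfolding couplings_def opt using prob_space.prob_space_distr[OF L hp] by simp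
qed

text \<open>When the positions are distinct, a coupling amounts to its matrix of masses at the pairs of positions, and
  \<open>comonotone_optimal\<close> applies to this matrix.\<close>

lemma coupling_cost_ge:
  fixes \<phi> :: "real \<Rightarrow> real"
  assumes x: "strict_mono_on {..<N1} x" and y: "strict_mono_on {..<N2} y"
    and \<phi>: "\<And>a a' b b'. a < a' \<Longrightarrow> b < b' \<Longrightarrow> \<phi> (a - b) + \<phi> (a' - b') \<le> \<phi> (a' - b) + \<phi> (a - b')"
      "\<And>z. 0 \<le> \<phi> z"
    and \<pi>: "\<pi> \<in> couplings (discrete_measure N1 m1 x) (discrete_measure N2 m2 y)"
  shows "ennreal (\<Sum>p\<in>pair_support. pair_weight p * \<phi> (x (fst p) - y (snd p)))
     \<le> (\<integral>\<^sup>+ (a, b). ennreal (\<phi> (a - b)) \<partial>\<pi>)"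
proof -
  have \<pi>': "prob_space \<pi>" "sets \<pi> = sets (borel \<Otimes>\<^sub>M borel)"
    "distr \<pi> borel fst = discrete_measure N1 m1 x" "distr \<pi> borel snd = discrete_measure N2 m2 y"
    using \<pi> by (auto simp: couplings_def)
  interpret prob_space \<pi> by (rule \<pi>')
  note [measurable_cong] = \<pi>'(2)
  have fst_m: "fst \<in> \<pi> \<rightarrow>\<^sub>M borel" and snd_m: "snd \<in> \<pi> \<rightarrow>\<^sub>M borel" by measurable
  have x_inj: "inj_on x {..<N1}" and y_inj: "inj_on y {..<N2}"
    using x y by (auto intro: strict_mono_on_imp_inj_on)
  have single: "{q} \<in> sets \<pi>" for q unfolding \<pi>'(2) by (rule singleton_sets_borel_pair)
  define a where "a i j = measure \<pi> {(x i, y j)}" for i j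
  have AE_fst: "AE q in \<pi>. fst q \<in> x ` {..<N1}"
    using fst_m by (rule AE_distrD) (simp only: \<pi>'(3) AE_discrete_measure)
  have AE_snd: "AE q in \<pi>. snd q \<in> y ` {..<N2}"
    using snd_m by (rule AE_distrD) (simp only: \<pi>'(4) AE_discrete_measure)
  have row: "(\<Sum>j<N2. a i j) = m1 i" if i: "i < N1" for i
  proof -
    have "(\<Sum>j<N2. a i j) = measure \<pi> (\<Union>j<N2. {(x i, y j)})"
      unfolding a_def using y_inj single
      by (intro finite_measure_finite_Union[symmetric]) (auto simp: disjoint_family_on_def inj_on_def)
    also have "\<dots> = measure \<pi> (fst -` {x i} \<inter> space \<pi>)"
    proof (rule finite_measure_eq_AE)
      show "AE q in \<pi>. q \<in> (\<Union>j<N2. {(x i, y j)}) \<longleftrightarrow> q \<in> fst -` {x i} \<inter> space \<pi>"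
        using AE_snd AE_space by eventually_elim auto
    qed (use single in \<open>auto intro!: measurable_sets[OF fst_m]\<close>)
    also have "\<dots> = measure (discrete_measure N1 m1 x) {x i}"
      unfolding \<pi>'(3)[symmetric] using fst_m by (simp add: measure_distr)
    also have "\<dots> = (\<Sum>k<N1. m1 k * indicator {x i} (x k))"
      by (rule M1.measure_discrete_measure) simp
    also have "\<dots> = (\<Sum>k<N1. if k = i then m1 k else 0)"
    proof (rule sum.cong[OF refl])
      fix k assume "k \<in> {..<N1}"
      then show "m1 k * indicator {x i} (x k) = (if k = i then m1 k else 0)"
        using inj_on_eq_iff[OF x_inj, of k i] i by simp
    qed
    finally show ?thesis using i by simp
  qed
  have col: "(\<Sum>i<N1. a i j) = m2 j" if j: "j < N2" for j
  proof -
    have "(\<Sum>i<N1. a i j) = measure \<pi> (\<Union>i<N1. {(x i, y j)})"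
      unfolding a_def using x_inj single
      by (intro finite_measure_finite_Union[symmetric]) (auto simp: disjoint_family_on_def inj_on_def)
    also have "\<dots> = measure \<pi> (snd -` {y j} \<inter> space \<pi>)"
    proof (rule finite_measure_eq_AE)
      show "AE q in \<pi>. q \<in> (\<Union>i<N1. {(x i, y j)}) \<longleftrightarrow> q \<in> snd -` {y j} \<inter> space \<pi>"
        using AE_fst AE_space by eventually_elim auto
    qed (use single in \<open>auto intro!: measurable_sets[OF snd_m]\<close>)
    also have "\<dots> = measure (discrete_measure N2 m2 y) {y j}"
      unfolding \<pi>'(4)[symmetric] using snd_m by (simp add: measure_distr)
    also have "\<dots> = (\<Sum>k<N2. m2 k * indicator {y j} (y k))"
      by (rule M2.measure_discrete_measure) simp
    also have "\<dots> = (\<Sum>k<N2. if k = j then m2 k else 0)"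
    proof (rule sum.cong[OF refl])
      fix k assume "k \<in> {..<N2}"
      then show "m2 k * indicator {y j} (y k) = (if k = j then m2 k else 0)"
        using inj_on_eq_iff[OF y_inj, of k j] j by simp
    qed
    finally show ?thesis using j by simp
  qed
  have "(\<Sum>p\<in>pair_support. pair_weight p * \<phi> (x (fst p) - y (snd p)))
      \<le> (\<Sum>i<N1. \<Sum>j<N2. a i j * \<phi> (x i - y j))"
  proof (rule comonotone_optimal[OF _ row col])
    fix k l assume "Suc k < N1" "Suc l < N2"
    then show "\<phi> (x k - y l) + \<phi> (x (Suc k) - y (Suc l)) \<le> \<phi> (x (Suc k) - y l) + \<phi> (x k - y (Suc l))"
      by (intro \<phi> strict_mono_onD[OF x] strict_mono_onD[OF y]) auto
  qed (simp add: a_def)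
  then have "ennreal (\<Sum>p\<in>pair_support. pair_weight p * \<phi> (x (fst p) - y (snd p)))
      \<le> ennreal (\<Sum>i<N1. \<Sum>j<N2. a i j * \<phi> (x i - y j))"
    by (rule ennreal_leI)
  also have "\<dots> = (\<Sum>(i, j)\<in>{..<N1} \<times> {..<N2}. ennreal (\<phi> (x i - y j)) * emeasure \<pi> {(x i, y j)})"
    unfolding sum.cartesian_product
    by (subst sum_ennreal[symmetric])
       (auto simp: a_def \<phi>(2) emeasure_eq_measure ennreal_mult mult.commute intro!: sum.cong)
  also have "\<dots> = (\<Sum>q\<in>map_prod x y ` ({..<N1} \<times> {..<N2}). ennreal (\<phi> (fst q - snd q)) * emeasure \<pi> {q})"
    using x_inj y_inj
    by (subst sum.reindex) (auto simp: inj_on_def intro!: sum.cong)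
  also have "\<dots> = (\<integral>\<^sup>+q. ennreal (\<phi> (fst q - snd q)) * indicator (map_prod x y ` ({..<N1} \<times> {..<N2})) q \<partial>\<pi>)"
    by (rule nn_integral_indicator_finite[symmetric]) (auto simp: single)
  also have "\<dots> \<le> (\<integral>\<^sup>+ (a, b). ennreal (\<phi> (a - b)) \<partial>\<pi>)"
    by (intro nn_integral_mono) (auto simp: indicator_def)
  finally show ?thesis .
qed

end

section \<open>Two sticky particle systems\<close>

lemma ennpowr_ennreal: "0 \<le> a \<Longrightarrow> ennpowr (ennreal a) q = ennreal (a powr q)"
  by (simp add: ennpowr_def)

lemma ennpowr_le_ennreal:
  assumes "c \<le> ennreal b" "0 \<le> b" "0 \<le> q"
  shows "ennpowr c q \<le> ennreal (b powr q)"
proof -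
  have "c \<noteq> \<infinity>" using assms(1) by (auto simp: top_unique)
  moreover have "enn2real c \<le> b" using assms by (intro enn2real_leI) auto
  ultimately show ?thesis
    using assms by (auto simp: ennpowr_def intro!: ennreal_leI powr_mono2)
qed

lemma abs_powr_2: "\<bar>z\<bar> powr 2 = (z::real)\<^sup>2"
  by (cases "z = 0") (simp_all add: powr_numeral)

lemma sum_ennreal_mult:
  assumes "\<And>i. i \<in> I \<Longrightarrow> 0 \<le> w i" "\<And>i. i \<in> I \<Longrightarrow> 0 \<le> f i"
  shows "(\<Sum>i\<in>I. ennreal (w i) * ennreal (f i)) = ennreal (\<Sum>i\<in>I. w i * f i)"
  using assms by (subst sum_ennreal[symmetric]) (auto simp: ennreal_mult)

context sticky_particles
begin

lemma position_mono_on: "0 \<le> t \<Longrightarrow> mono_on {..<N} (\<lambda>i. X i t)"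
  by (auto intro!: mono_onI position_ordered)

lemma initial_strict_mono_on: "strict_mono_on {..<N} x"
  by (auto intro!: strict_mono_onI initial_ordered)

lemma initial_mono_on: "mono_on {..<N} x"
  by (rule strict_mono_on_imp_mono_on[OF initial_strict_mono_on])

lemma velocity_evolution:
  assumes "i < N" "0 \<le> t"
  shows "velocity (discrete_datum N m (\<lambda>i. X i t) (\<lambda>i. V i t)) (X i t) = V i t"
proof -
  interpret mass_distribution N m by (rule mass_distribution)
  show ?thesis
    using velocity_discrete_datum[of i "\<lambda>i. X i t" "\<lambda>i. V i t"] velocity_eq_in_cluster assms by blast
qed

lemma velocity_initial:
  assumes "i < N" shows "velocity (discrete_datum N m x v) (x i) = v i"
proof -
  interpret mass_distribution N m by (rule mass_distribution)
  have inj: "inj_on x {..<N}" by (rule strict_mono_on_imp_inj_on[OF initial_strict_mono_on])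
  show ?thesis
    by (rule velocity_discrete_datum[OF assms]) (use inj in \<open>auto dest: inj_onD\<close>)
qed

lemma moment_norm_initial:
  "moment_norm 2 (discrete_datum N m x v) = ennreal (sqrt (\<Sum>i<N. m i * ((x i)\<^sup>2 + (v i)\<^sup>2)))"
proof -
  have nn: "0 \<le> (\<Sum>i<N. m i * ((x i)\<^sup>2 + (v i)\<^sup>2))"
    using less_imp_le[OF mass_pos] by (intro sum_nonneg mult_nonneg_nonneg) auto
  have fst_eq: "fst (discrete_datum N m x v) = discrete_measure N m x"
    by (simp add: discrete_datum_def)
  have "(\<integral>\<^sup>+ y. ennreal (\<bar>y\<bar> powr 2 + \<bar>velocity (discrete_datum N m x v) y\<bar> powr 2) \<partial>discrete_measure N m x)
      = (\<Sum>i<N. ennreal (m i) * ennreal ((x i)\<^sup>2 + (v i)\<^sup>2))"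
    unfolding nn_integral_discrete_measure by (intro sum.cong) (auto simp: velocity_initial abs_powr_2)
  also have "\<dots> = ennreal (\<Sum>i<N. m i * ((x i)\<^sup>2 + (v i)\<^sup>2))"
    using mass_pos by (intro sum_ennreal_mult) (auto intro: less_imp_le)
  finally show ?thesis
    unfolding moment_norm_def fst_eq by (simp only: ennpowr_ennreal[OF nn] powr_half_sqrt[OF nn])
qed

end

locale two_systems =
  S1: sticky_particles N1 m1 x1 v1 X1 V1 + S2: sticky_particles N2 m2 x2 v2 X2 V2
  for N1 m1 x1 v1 X1 V1 N2 m2 x2 v2 X2 V2
begin

sublocale mass_pair N1 m1 N2 m2
  unfolding mass_pair_def using S1.mass_distribution S2.mass_distribution by blast

sublocale sticky_pair N1 m1 x1 v1 X1 V1 N2 m2 x2 v2 X2 V2 pair_support pair_weight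
  by unfold_locales

abbreviation "datum1 t \<equiv> discrete_datum N1 m1 (\<lambda>i. X1 i t) (\<lambda>i. V1 i t)"
abbreviation "datum2 t \<equiv> discrete_datum N2 m2 (\<lambda>i. X2 i t) (\<lambda>i. V2 i t)"
abbreviation "initial1 \<equiv> discrete_datum N1 m1 x1 v1"
abbreviation "initial2 \<equiv> discrete_datum N2 m2 x2 v2"

definition lp_norm :: "real \<Rightarrow> (nat \<times> nat \<Rightarrow> real) \<Rightarrow> real" where
  "lp_norm p f = (\<Sum>q\<in>pair_support. pair_weight q * \<bar>f q\<bar> powr p) powr (1 / p)"

lemma lp_sum_nonneg: "0 \<le> (\<Sum>q\<in>pair_support. pair_weight q * \<bar>f q\<bar> powr p)"
  using weight_pos by (intro sum_nonneg mult_nonneg_nonneg) (auto intro: less_imp_le)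

lemma lp_norm_nonneg: "0 \<le> lp_norm p f"
  by (simp add: lp_norm_def)

lemma lp_norm_2: "lp_norm 2 f = sqrt (wip pair_support pair_weight f f)"
  using lp_sum_nonneg[of f 2]
  by (simp add: lp_norm_def abs_powr_2 powr_half_sqrt wip_def power2_eq_square mult.assoc)

lemma transport_cost_le:
  assumes "0 \<le> t"
  shows "transport_cost \<psi> (fst (datum1 t)) (fst (datum2 t))
    \<le> (\<Sum>q\<in>pair_support. ennreal (pair_weight q) * \<psi> (X1 (fst q) t - X2 (snd q) t))"
  unfolding transport_cost_def discrete_datum_def fst_conv
  by (rule INF_lower2[OF optimal_coupling_in_couplings])
     (simp_all add: S1.position_mono_on S2.position_mono_on assms nn_integral_optimal_coupling)

lemma transport_cost_contraction:
  assumes \<psi>: "convex_enn \<psi>" "\<And>z. \<psi> (- z) = \<psi> z" "lower_semicontinuous \<psi>" and t: "0 \<le> t"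
  shows "transport_cost \<psi> (fst (datum1 t)) (fst (datum2 t))
    \<le> (\<integral>\<^sup>+ (x, y). \<psi> (x + t * velocity initial1 x - (y + t * velocity initial2 y))
          \<partial>optimal_coupling (fst initial1) (fst initial2))"
proof -
  have "transport_cost \<psi> (fst (datum1 t)) (fst (datum2 t))
    \<le> (\<Sum>q\<in>pair_support. ennreal (pair_weight q) *
        \<psi> (x1 (fst q) + t * v1 (fst q) - (x2 (snd q) + t * v2 (snd q))))"
    by (rule order.trans[OF transport_cost_le[OF t] convex_enn_contraction[OF \<psi> t]])
  also have "\<dots> = (\<integral>\<^sup>+ (x, y). \<psi> (x + t * velocity initial1 x - (y + t * velocity initial2 y))
          \<partial>optimal_coupling (discrete_measure N1 m1 x1) (discrete_measure N2 m2 x2))"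
    unfolding nn_integral_optimal_coupling[OF S1.initial_mono_on S2.initial_mono_on]
    by (intro sum.cong refl) (simp add: S1.velocity_initial S2.velocity_initial fst_less snd_less)
  finally show ?thesis by (simp add: discrete_datum_def)
qed

lemma lp_norm_contraction:
  assumes p: "1 \<le> p" and t: "0 \<le> t"
  shows "lp_norm p (\<lambda>q. X1 (fst q) t - X2 (snd q) t)
     \<le> lp_norm p (\<lambda>q. x1 (fst q) - x2 (snd q)) + t * lp_norm p (\<lambda>q. v1 (fst q) - v2 (snd q))"
proof -
  have "lp_norm p (\<lambda>q. X1 (fst q) t - X2 (snd q) t)
      \<le> lp_norm p (\<lambda>q. x1 (fst q) + t * v1 (fst q) - (x2 (snd q) + t * v2 (snd q)))"
    unfolding lp_norm_def using p t
    by (intro powr_mono2 lp_sum_nonneg convex_contraction[OF convex_on_abs_powr[OF p] open_UNIV]) auto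
  also have "\<dots> = lp_norm p (\<lambda>q. (x1 (fst q) - x2 (snd q)) + t * (v1 (fst q) - v2 (snd q)))"
    by (simp add: algebra_simps)
  also have "\<dots> \<le> lp_norm p (\<lambda>q. x1 (fst q) - x2 (snd q)) + lp_norm p (\<lambda>q. t * (v1 (fst q) - v2 (snd q)))"
    unfolding lp_norm_def using weight_pos by (intro minkowski_sum[OF p]) (auto intro: less_imp_le)
  also have "lp_norm p (\<lambda>q. t * (v1 (fst q) - v2 (snd q))) = t * lp_norm p (\<lambda>q. v1 (fst q) - v2 (snd q))"
  proof -
    have "(\<Sum>q\<in>pair_support. pair_weight q * \<bar>t * (v1 (fst q) - v2 (snd q))\<bar> powr p)
        = t powr p * (\<Sum>q\<in>pair_support. pair_weight q * \<bar>v1 (fst q) - v2 (snd q)\<bar> powr p)"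
      using t by (simp add: abs_mult powr_mult sum_distrib_left mult_ac)
    then show ?thesis
      using t p lp_sum_nonneg by (simp add: lp_norm_def powr_mult powr_powr)
  qed
  finally show ?thesis .
qed

text \<open>The upper bound comes from the monotone coupling itself, the lower one from its optimality.\<close>

lemma wasserstein_initial:
  assumes p: "1 \<le> p"
  shows "wasserstein p (fst initial1) (fst initial2) = ennreal (lp_norm p (\<lambda>q. x1 (fst q) - x2 (snd q)))"
proof -
  let ?S = "\<Sum>q\<in>pair_support. pair_weight q * \<bar>x1 (fst q) - x2 (snd q)\<bar> powr p"
  have "transport_cost (\<lambda>z. ennreal (\<bar>z\<bar> powr p)) (discrete_measure N1 m1 x1) (discrete_measure N2 m2 x2) = ennreal ?S"
  proof (rule antisym)
    have "(\<integral>\<^sup>+ (x, y). ennreal (\<bar>x - y\<bar> powr p) \<partial>optimal_coupling (discrete_measure N1 m1 x1) (discrete_measure N2 m2 x2))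
        = ennreal ?S"
      unfolding nn_integral_optimal_coupling[OF S1.initial_mono_on S2.initial_mono_on] prod.case
      using weight_pos by (intro sum_ennreal_mult) (auto intro: less_imp_le)
    then show "transport_cost (\<lambda>z. ennreal (\<bar>z\<bar> powr p)) (discrete_measure N1 m1 x1) (discrete_measure N2 m2 x2) \<le> ennreal ?S"
      unfolding transport_cost_def
      by (intro INF_lower2[OF optimal_coupling_in_couplings[OF S1.initial_mono_on S2.initial_mono_on]]) simp
    show "ennreal ?S \<le> transport_cost (\<lambda>z. ennreal (\<bar>z\<bar> powr p)) (discrete_measure N1 m1 x1) (discrete_measure N2 m2 x2)"
      unfolding transport_cost_def
      by (intro INF_greatest coupling_cost_ge[where \<phi>="\<lambda>z. \<bar>z\<bar> powr p"] S1.initial_strict_mono_on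
          S2.initial_strict_mono_on convex_monge[OF convex_on_abs_powr[OF p]]) auto
  qed
  then show ?thesis
    using lp_sum_nonneg by (simp add: wasserstein_def discrete_datum_def ennpowr_ennreal lp_norm_def)
qed

lemma velocity_dist_initial:
  "velocity_dist p initial1 initial2 = ennreal (lp_norm p (\<lambda>q. v1 (fst q) - v2 (snd q)))"
proof -
  have "(\<integral>\<^sup>+ (x, y). ennreal (\<bar>velocity initial1 x - velocity initial2 y\<bar> powr p)
        \<partial>optimal_coupling (discrete_measure N1 m1 x1) (discrete_measure N2 m2 x2))
      = (\<Sum>q\<in>pair_support. ennreal (pair_weight q) * ennreal (\<bar>v1 (fst q) - v2 (snd q)\<bar> powr p))"
    unfolding nn_integral_optimal_coupling[OF S1.initial_mono_on S2.initial_mono_on]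
    by (intro sum.cong refl) (simp add: S1.velocity_initial S2.velocity_initial fst_less snd_less)
  also have "\<dots> = ennreal (\<Sum>q\<in>pair_support. pair_weight q * \<bar>v1 (fst q) - v2 (snd q)\<bar> powr p)"
    using weight_pos by (intro sum_ennreal_mult) (auto intro: less_imp_le)
  finally show ?thesis
    using lp_sum_nonneg by (simp add: velocity_dist_def discrete_datum_def ennpowr_ennreal lp_norm_def)
qed

lemma velocity_dist_evolution:
  assumes t: "0 \<le> t"
  shows "velocity_dist p (datum1 t) (datum2 t) = ennreal (lp_norm p (\<lambda>q. V1 (fst q) t - V2 (snd q) t))"
proof -
  have "(\<integral>\<^sup>+ (x, y). ennreal (\<bar>velocity (datum1 t) x - velocity (datum2 t) y\<bar> powr p)
        \<partial>optimal_coupling (discrete_measure N1 m1 (\<lambda>i. X1 i t)) (discrete_measure N2 m2 (\<lambda>i. X2 i t)))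
      = (\<Sum>q\<in>pair_support. ennreal (pair_weight q) * ennreal (\<bar>V1 (fst q) t - V2 (snd q) t\<bar> powr p))"
    unfolding nn_integral_optimal_coupling[OF S1.position_mono_on[OF t] S2.position_mono_on[OF t]]
    using t by (intro sum.cong refl) (simp add: S1.velocity_evolution S2.velocity_evolution fst_less snd_less)
  also have "\<dots> = ennreal (\<Sum>q\<in>pair_support. pair_weight q * \<bar>V1 (fst q) t - V2 (snd q) t\<bar> powr p)"
    using weight_pos by (intro sum_ennreal_mult) (auto intro: less_imp_le)
  finally show ?thesis
    using lp_sum_nonneg by (simp add: velocity_dist_def discrete_datum_def ennpowr_ennreal lp_norm_def)
qed

lemma wasserstein_contraction:
  assumes p: "1 \<le> p" and t: "0 \<le> t"
  shows "wasserstein p (fst (datum1 t)) (fst (datum2 t))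
     \<le> wasserstein p (fst initial1) (fst initial2) + ennreal t * velocity_dist p initial1 initial2"
proof -
  have "transport_cost (\<lambda>z. ennreal (\<bar>z\<bar> powr p)) (fst (datum1 t)) (fst (datum2 t))
      \<le> (\<Sum>q\<in>pair_support. ennreal (pair_weight q) * ennreal (\<bar>X1 (fst q) t - X2 (snd q) t\<bar> powr p))"
    by (rule transport_cost_le[OF t])
  also have "\<dots> = ennreal (\<Sum>q\<in>pair_support. pair_weight q * \<bar>X1 (fst q) t - X2 (snd q) t\<bar> powr p)"
    using weight_pos by (intro sum_ennreal_mult) (auto intro: less_imp_le)
  finally have "wasserstein p (fst (datum1 t)) (fst (datum2 t)) \<le> ennreal (lp_norm p (\<lambda>q. X1 (fst q) t - X2 (snd q) t))"
    unfolding wasserstein_def lp_norm_def using p by (intro ennpowr_le_ennreal lp_sum_nonneg) auto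
  also have "\<dots> \<le> ennreal (lp_norm p (\<lambda>q. x1 (fst q) - x2 (snd q)) + t * lp_norm p (\<lambda>q. v1 (fst q) - v2 (snd q)))"
    by (rule ennreal_leI[OF lp_norm_contraction[OF p t]])
  finally show ?thesis
    using t by (simp add: wasserstein_initial[OF p] velocity_dist_initial ennreal_plus ennreal_mult lp_norm_nonneg)
qed

text \<open>In terms of pairs of indices the two systems interact through polarity only. Equalities come from applying
  it to a profile and to its negative, which is possible when the profile is constant on clusters.\<close>

lemma loss_polar_fst:
  assumes r: "0 \<le> r"
    and z: "\<And>p q. p \<in> pair_support \<Longrightarrow> q \<in> pair_support \<Longrightarrow> fst p < fst q \<Longrightarrow> X1 (fst p) r = X1 (fst q) r \<Longrightarrow> z p \<le> z q"
  shows "wip pair_support pair_weight (\<lambda>p. V1 (fst p) 0 - V1 (fst p) r) z \<le> 0"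
proof -
  have "wip pair_support pair_weight (\<lambda>p. V1 (fst p) 0 - V1 (fst p) r) z
      = (\<Sum>p\<in>pair_support. pair_weight p * (v1 (fst p) - V1 (fst p) r) * z p)"
    unfolding wip_def by (intro sum.cong refl) (simp add: S1.initial_velocity fst_less)
  then show ?thesis
    using polar_lift_fst[where h="\<lambda>i. v1 i - V1 i r", OF S1.velocity_loss_polar[OF r] z] by simp
qed

lemma loss_polar_snd:
  assumes r: "0 \<le> r"
    and z: "\<And>p q. p \<in> pair_support \<Longrightarrow> q \<in> pair_support \<Longrightarrow> snd p < snd q \<Longrightarrow> X2 (snd p) r = X2 (snd q) r \<Longrightarrow> z p \<le> z q"
  shows "wip pair_support pair_weight (\<lambda>p. V2 (snd p) 0 - V2 (snd p) r) z \<le> 0"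
proof -
  have "wip pair_support pair_weight (\<lambda>p. V2 (snd p) 0 - V2 (snd p) r) z
      = (\<Sum>p\<in>pair_support. pair_weight p * (v2 (snd p) - V2 (snd p) r) * z p)"
    unfolding wip_def by (intro sum.cong refl) (simp add: S2.initial_velocity snd_less)
  then show ?thesis
    using polar_lift_snd[where h="\<lambda>i. v2 i - V2 i r", OF S2.velocity_loss_polar[OF r] z] by simp
qed

lemma loss_orthogonal_fst:
  assumes r: "0 \<le> r"
    and f: "\<And>i j. i < N1 \<Longrightarrow> j < N1 \<Longrightarrow> X1 i r = X1 j r \<Longrightarrow> f i = f j"
  shows "wip pair_support pair_weight (\<lambda>p. V1 (fst p) 0 - V1 (fst p) r) (\<lambda>p. f (fst p)) = 0"
proof (rule antisym)
  show "wip pair_support pair_weight (\<lambda>p. V1 (fst p) 0 - V1 (fst p) r) (\<lambda>p. f (fst p)) \<le> 0"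
    by (rule loss_polar_fst[OF r]) (auto intro!: eq_refl f fst_less)
  have "wip pair_support pair_weight (\<lambda>p. V1 (fst p) 0 - V1 (fst p) r) (\<lambda>p. (- 1) * f (fst p)) \<le> 0"
    by (rule loss_polar_fst[OF r]) (auto intro!: eq_refl f fst_less)
  then show "0 \<le> wip pair_support pair_weight (\<lambda>p. V1 (fst p) 0 - V1 (fst p) r) (\<lambda>p. f (fst p))"
    unfolding wip_scale_right by simp
qed

lemma loss_orthogonal_snd:
  assumes r: "0 \<le> r"
    and f: "\<And>i j. i < N2 \<Longrightarrow> j < N2 \<Longrightarrow> X2 i r = X2 j r \<Longrightarrow> f i = f j"
  shows "wip pair_support pair_weight (\<lambda>p. V2 (snd p) 0 - V2 (snd p) r) (\<lambda>p. f (snd p)) = 0"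
proof (rule antisym)
  show "wip pair_support pair_weight (\<lambda>p. V2 (snd p) 0 - V2 (snd p) r) (\<lambda>p. f (snd p)) \<le> 0"
    by (rule loss_polar_snd[OF r]) (auto intro!: eq_refl f snd_less)
  have "wip pair_support pair_weight (\<lambda>p. V2 (snd p) 0 - V2 (snd p) r) (\<lambda>p. (- 1) * f (snd p)) \<le> 0"
    by (rule loss_polar_snd[OF r]) (auto intro!: eq_refl f snd_less)
  then show "0 \<le> wip pair_support pair_weight (\<lambda>p. V2 (snd p) 0 - V2 (snd p) r) (\<lambda>p. f (snd p))"
    unfolding wip_scale_right by simp
qed

sublocale flows: interacting_flows pair_support pair_weight
  "\<lambda>r p. X1 (fst p) r" "\<lambda>r p. X2 (snd p) r" "\<lambda>r p. V1 (fst p) r" "\<lambda>r p. V2 (snd p) r"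
  "collision_times N1 X1 \<union> collision_times N2 X2"
proof
  show "wip pair_support pair_weight (\<lambda>p. V1 (fst p) 0 - V1 (fst p) r) (\<lambda>p. V1 (fst p) s) = 0"
    if rs: "0 \<le> r" "r \<le> s" for r s
  proof (rule loss_orthogonal_fst[where f="\<lambda>i. V1 i s", OF rs(1)])
    fix i j assume ij: "i < N1" "j < N1" "X1 i r = X1 j r"
    show "V1 i s = V1 j s"
      by (rule S1.velocity_eq_in_cluster[OF ij(1,2) order.trans[OF rs] S1.clusters_persist[OF ij(1,2) rs ij(3)]])
  qed
  show "wip pair_support pair_weight (\<lambda>p. V2 (snd p) 0 - V2 (snd p) r) (\<lambda>p. V2 (snd p) s) = 0"
    if rs: "0 \<le> r" "r \<le> s" for r s
  proof (rule loss_orthogonal_snd[where f="\<lambda>i. V2 i s", OF rs(1)])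
    fix i j assume ij: "i < N2" "j < N2" "X2 i r = X2 j r"
    show "V2 i s = V2 j s"
      by (rule S2.velocity_eq_in_cluster[OF ij(1,2) order.trans[OF rs] S2.clusters_persist[OF ij(1,2) rs ij(3)]])
  qed
  show "wip pair_support pair_weight (\<lambda>p. V1 (fst p) 0 - V1 (fst p) r) (\<lambda>p. X1 (fst p) r) = 0" if "0 \<le> r" for r
    by (rule loss_orthogonal_fst[where f="\<lambda>i. X1 i r", OF that])
  show "wip pair_support pair_weight (\<lambda>p. V2 (snd p) 0 - V2 (snd p) r) (\<lambda>p. X2 (snd p) r) = 0" if "0 \<le> r" for r
    by (rule loss_orthogonal_snd[where f="\<lambda>i. X2 i r", OF that])
  show "wip pair_support pair_weight (\<lambda>p. V1 (fst p) 0 - V1 (fst p) r) (\<lambda>p. X2 (snd p) s) \<le> 0"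
    if "0 \<le> r" "0 \<le> s" for r s
    by (rule loss_polar_fst[OF that(1)], rule S2.position_ordered)
       (use that comonotone snd_less in auto)
  show "wip pair_support pair_weight (\<lambda>p. V2 (snd p) 0 - V2 (snd p) r) (\<lambda>p. X1 (fst p) s) \<le> 0"
    if "0 \<le> r" "0 \<le> s" for r s
    by (rule loss_polar_snd[OF that(1)], rule S1.position_ordered)
       (use that comonotone_snd fst_less in auto)
  show "finite pair_support" by (rule finite_support)
  show "finite (collision_times N1 X1 \<union> collision_times N2 X2)"
    using S1.finite_collision_times S2.finite_collision_times by simp
  fix p assume p: "p \<in> pair_support"
  show "0 < pair_weight p" by (rule weight_pos[OF p])
  show "continuous_on {0..} (\<lambda>r. X1 (fst p) r)"
    by (rule S1.position_continuous[OF fst_less[OF p]])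
  show "((\<lambda>r. X1 (fst p) r) has_real_derivative V1 (fst p) r) (at_right r)" if "0 \<le> r" for r
    by (rule S1.velocity_right_derivative[OF fst_less[OF p] that])
  show "((\<lambda>r. X1 (fst p) r) has_real_derivative V1 (fst p) r) (at r)"
    if "0 < r" "r \<notin> collision_times N1 X1 \<union> collision_times N2 X2" for r
    using that by (intro S1.position_derivative[OF fst_less[OF p]]) auto
  show "continuous_on {0..} (\<lambda>r. X2 (snd p) r)"
    by (rule S2.position_continuous[OF snd_less[OF p]])
  show "((\<lambda>r. X2 (snd p) r) has_real_derivative V2 (snd p) r) (at_right r)" if "0 \<le> r" for r
    by (rule S2.velocity_right_derivative[OF snd_less[OF p] that])
  show "((\<lambda>r. X2 (snd p) r) has_real_derivative V2 (snd p) r) (at r)"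
    if "0 < r" "r \<notin> collision_times N1 X1 \<union> collision_times N2 X2" for r
    using that by (intro S2.position_derivative[OF snd_less[OF p]]) auto
qed

abbreviation "W0 \<equiv> lp_norm 2 (\<lambda>q. x1 (fst q) - x2 (snd q))"
abbreviation "U0 \<equiv> lp_norm 2 (\<lambda>q. v1 (fst q) - v2 (snd q))"
abbreviation "norm1 \<equiv> sqrt (\<Sum>i<N1. m1 i * ((x1 i)\<^sup>2 + (v1 i)\<^sup>2))"
abbreviation "norm2 \<equiv> sqrt (\<Sum>i<N2. m2 i * ((x2 i)\<^sup>2 + (v2 i)\<^sup>2))"

lemma moments_le:
  "(\<Sum>i<N1. m1 i * (x1 i)\<^sup>2) + (\<Sum>i<N2. m2 i * (x2 i)\<^sup>2) \<le> (norm1 + norm2)\<^sup>2"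
  "(\<Sum>i<N1. m1 i * (v1 i)\<^sup>2) + (\<Sum>i<N2. m2 i * (v2 i)\<^sup>2) \<le> (norm1 + norm2)\<^sup>2"
proof -
  have nn: "0 \<le> (\<Sum>i<N1. m1 i * (x1 i)\<^sup>2)" "0 \<le> (\<Sum>i<N1. m1 i * (v1 i)\<^sup>2)"
    "0 \<le> (\<Sum>i<N2. m2 i * (x2 i)\<^sup>2)" "0 \<le> (\<Sum>i<N2. m2 i * (v2 i)\<^sup>2)"
    using less_imp_le[OF S1.mass_pos] less_imp_le[OF S2.mass_pos]
    by (auto intro!: sum_nonneg mult_nonneg_nonneg)
  have "norm1\<^sup>2 + norm2\<^sup>2 \<le> (norm1 + norm2)\<^sup>2"
    using nn by (simp add: power2_sum distrib_left sum.distrib)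
  moreover have "norm1\<^sup>2 = (\<Sum>i<N1. m1 i * (x1 i)\<^sup>2) + (\<Sum>i<N1. m1 i * (v1 i)\<^sup>2)"
    "norm2\<^sup>2 = (\<Sum>i<N2. m2 i * (x2 i)\<^sup>2) + (\<Sum>i<N2. m2 i * (v2 i)\<^sup>2)"
    using nn by (simp_all add: distrib_left sum.distrib)
  ultimately show "(\<Sum>i<N1. m1 i * (x1 i)\<^sup>2) + (\<Sum>i<N2. m2 i * (x2 i)\<^sup>2) \<le> (norm1 + norm2)\<^sup>2"
    "(\<Sum>i<N1. m1 i * (v1 i)\<^sup>2) + (\<Sum>i<N2. m2 i * (v2 i)\<^sup>2) \<le> (norm1 + norm2)\<^sup>2"
    using nn by linarith+
qed

lemma lp_norm_2_difference_le:
  assumes "(\<Sum>i<N1. m1 i * (f i)\<^sup>2) + (\<Sum>i<N2. m2 i * (h i)\<^sup>2) \<le> a\<^sup>2" "0 \<le> a"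
  shows "lp_norm 2 (\<lambda>q. f (fst q) - h (snd q)) \<le> 2 * a"
proof -
  have "wip pair_support pair_weight (\<lambda>q. f (fst q) - h (snd q)) (\<lambda>q. f (fst q) - h (snd q))
      \<le> (\<Sum>q\<in>pair_support. 2 * (pair_weight q * (f (fst q))\<^sup>2) + 2 * (pair_weight q * (h (snd q))\<^sup>2))"
    unfolding wip_def
  proof (rule sum_mono)
    fix q assume q: "q \<in> pair_support"
    have "0 \<le> pair_weight q * (f (fst q) + h (snd q))\<^sup>2"
      using weight_pos[OF q] by simp
    then show "pair_weight q * (f (fst q) - h (snd q)) * (f (fst q) - h (snd q))
        \<le> 2 * (pair_weight q * (f (fst q))\<^sup>2) + 2 * (pair_weight q * (h (snd q))\<^sup>2)"
      by (simp add: power2_eq_square algebra_simps)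
  qed
  also have "\<dots> = 2 * ((\<Sum>i<N1. m1 i * (f i)\<^sup>2) + (\<Sum>i<N2. m2 i * (h i)\<^sup>2))"
    using sum_fst[of "\<lambda>i. (f i)\<^sup>2"] sum_snd[of "\<lambda>i. (h i)\<^sup>2"]
    by (simp add: sum.distrib sum_distrib_left[symmetric])
  also have "\<dots> \<le> 2 * a\<^sup>2"
    using assms(1) by (rule mult_left_mono) simp
  also have "\<dots> \<le> (2 * a)\<^sup>2"
    by (simp add: power_mult_distrib)
  finally show ?thesis
    using assms(2) unfolding lp_norm_2 by (intro real_le_lsqrt) auto
qed

text \<open>The theorem on abstract flows is used with \<open>d = 5 (1 + t) \<delta>\<close>, which bounds the distance of the positions up
  to time \<open>t + h\<close>, and with \<open>h = (1 + t) \<delta> / a\<close>, which makes all the terms of the same order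
  \<open>(1 + t) a \<delta>\<close>. The upper bounds \<open>a\<close> and \<open>\<delta>\<close> of the norms are positive to avoid a division by zero; a limit
  replaces them by the norms themselves. The constant is \<open>119 = 40 + 4 + 75\<close>, one summand for each term.\<close>

lemma velocity_stability_aux:
  assumes t: "0 \<le> t" and a: "norm1 + norm2 \<le> a" "0 < a" and \<delta>: "W0 + U0 \<le> \<delta>" "0 < \<delta>" "\<delta> \<le> 4 * a"
  shows "integral {0..t} (\<lambda>r. flows.ip (flows.vgap r) (flows.vgap r)) \<le> 119 * (1 + t) * a * \<delta>"
proof -
  define h where "h = (1 + t) * \<delta> / a"
  define d where "d = 5 * ((1 + t) * \<delta>)"
  have h: "0 < h" using t a \<delta> by (simp add: h_def)
  have "(1 + t) * \<delta> \<le> (1 + t) * (4 * a)" using t \<delta> by (intro mult_left_mono) auto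
  then have h_le: "h \<le> 4 * (1 + t)" using a by (simp add: h_def pos_divide_le_eq mult_ac)
  have norms: "0 \<le> norm1 + norm2"
    using less_imp_le[OF S1.mass_pos] less_imp_le[OF S2.mass_pos]
    by (intro add_nonneg_nonneg real_sqrt_ge_zero sum_nonneg mult_nonneg_nonneg) auto
  have sq: "(norm1 + norm2)\<^sup>2 \<le> a\<^sup>2" using norms a by (intro power_mono) auto
  have W: "0 \<le> W0" and U: "0 \<le> U0" by (rule lp_norm_nonneg)+
  have U_le: "U0 \<le> 2 * a"
    using lp_norm_2_difference_le[of v1 v2 a] moments_le(2) sq a by simp
  have ip0: "flows.ip (flows.vgap 0) (flows.vgap 0) = U0\<^sup>2"
  proof -
    have "flows.ip (flows.vgap 0) (flows.vgap 0)
        = wip pair_support pair_weight (\<lambda>q. v1 (fst q) - v2 (snd q)) (\<lambda>q. v1 (fst q) - v2 (snd q))"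
      unfolding wip_def flows.vgap_def
      by (intro sum.cong refl) (simp add: S1.initial_velocity S2.initial_velocity fst_less snd_less)
    then show ?thesis by (simp add: lp_norm_2 wip_nonneg weight_pos)
  qed
  have gap: "flows.ip (flows.gap r) (flows.gap r) \<le> d\<^sup>2" if r: "r \<in> {0..t + h}" for r
  proof -
    have "sqrt (flows.ip (flows.gap r) (flows.gap r)) = lp_norm 2 (\<lambda>q. X1 (fst q) r - X2 (snd q) r)"
      by (simp add: lp_norm_2 flows.gap_def[abs_def])
    also have "\<dots> \<le> W0 + r * U0"
      using r by (intro lp_norm_contraction) auto
    also have "\<dots> \<le> (1 + r) * (W0 + U0)"
      using r W U by (simp add: algebra_simps)
    also have "\<dots> \<le> (1 + r) * \<delta>"
      using r \<delta> by (intro mult_left_mono) auto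
    also have "\<dots> \<le> (5 * (1 + t)) * \<delta>"
      using r h_le \<delta> by (intro mult_right_mono) auto
    finally have "sqrt (flows.ip (flows.gap r) (flows.gap r)) \<le> d" by (simp add: d_def mult_ac)
    then show ?thesis by (rule sqrt_le_D)
  qed
  have "integral {0..t} (\<lambda>r. flows.ip (flows.vgap r) (flows.vgap r))
      \<le> 4 * U0 * d + 4 * h * flows.energy 0 + 3 * d\<^sup>2 / h"
  proof (rule flows.velocity_gap_bound[OF t h U _ _ _ gap])
    show "0 \<le> d" using t \<delta> by (simp add: d_def)
    have "t * U0 \<le> (1 + t) * \<delta>" using t U W \<delta> by (intro mult_mono) auto
    also have "\<dots> \<le> d" using t \<delta> by (simp add: d_def)
    finally show "t * U0 \<le> d" .
  qed (simp add: ip0)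
  also have "4 * U0 * d \<le> 40 * ((1 + t) * a * \<delta>)"
    using mult_right_mono[OF U_le, of "20 * ((1 + t) * \<delta>)"] t \<delta> by (simp add: d_def algebra_simps)
  also have "4 * h * flows.energy 0 \<le> 4 * h * a\<^sup>2"
  proof (rule mult_left_mono)
    have "flows.energy 0 = (\<Sum>i<N1. m1 i * (v1 i)\<^sup>2) + (\<Sum>i<N2. m2 i * (v2 i)\<^sup>2)"
      unfolding flows.energy_def wip_def sum_fst[symmetric] sum_snd[symmetric]
      by (intro arg_cong2[where f="(+)"] sum.cong refl)
         (simp_all add: S1.initial_velocity S2.initial_velocity power2_eq_square fst_less snd_less)
    then show "flows.energy 0 \<le> a\<^sup>2" using moments_le(2) sq by simp
  qed (use h in simp)
  also have "4 * h * a\<^sup>2 = 4 * ((1 + t) * a * \<delta>)"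
    using a by (simp add: h_def power2_eq_square)
  also have "3 * d\<^sup>2 / h = 75 * ((1 + t) * a * \<delta>)"
    using t a \<delta> by (simp add: h_def d_def power2_eq_square)
  finally show ?thesis by (simp add: algebra_simps)
qed

theorem velocity_stability:
  assumes t: "0 \<le> t"
  shows "integral {0..t} (\<lambda>r. flows.ip (flows.vgap r) (flows.vgap r))
     \<le> 119 * (1 + t) * (norm1 + norm2) * (W0 + U0)"
proof -
  have norms: "0 \<le> norm1 + norm2"
    using less_imp_le[OF S1.mass_pos] less_imp_le[OF S2.mass_pos]
    by (intro add_nonneg_nonneg real_sqrt_ge_zero sum_nonneg mult_nonneg_nonneg) auto
  have W: "0 \<le> W0" and U: "0 \<le> U0" by (rule lp_norm_nonneg)+
  have WU: "W0 \<le> 2 * (norm1 + norm2)" "U0 \<le> 2 * (norm1 + norm2)"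
    by (rule lp_norm_2_difference_le[OF moments_le(1) norms], rule lp_norm_2_difference_le[OF moments_le(2) norms])
  have bound: "integral {0..t} (\<lambda>r. flows.ip (flows.vgap r) (flows.vgap r))
      \<le> 119 * (1 + t) * (norm1 + norm2 + \<epsilon>) * (W0 + U0 + \<epsilon>)" if "0 < \<epsilon>" for \<epsilon>
    using that norms W U WU by (intro velocity_stability_aux[OF t]) auto
  have lim: "((\<lambda>\<epsilon>. 119 * (1 + t) * (norm1 + norm2 + \<epsilon>) * (W0 + U0 + \<epsilon>)) \<longlongrightarrow>
      119 * (1 + t) * (norm1 + norm2 + 0) * (W0 + U0 + 0)) (at_right 0)"
    by (intro tendsto_intros)
  have "integral {0..t} (\<lambda>r. flows.ip (flows.vgap r) (flows.vgap r))
      \<le> 119 * (1 + t) * (norm1 + norm2 + 0) * (W0 + U0 + 0)"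
  proof (rule tendsto_lowerbound[OF lim])
    show "\<forall>\<^sub>F \<epsilon> in at_right 0. integral {0..t} (\<lambda>r. flows.ip (flows.vgap r) (flows.vgap r))
        \<le> 119 * (1 + t) * (norm1 + norm2 + \<epsilon>) * (W0 + U0 + \<epsilon>)"
      by (rule eventually_at_rightI[of 0 1], rule bound) simp_all
  qed simp
  then show ?thesis by simp
qed

lemma velocity_dist_integral_bound:
  assumes t: "0 \<le> t"
  shows "(\<integral>\<^sup>+ r\<in>{0..t}. (velocity_dist 2 (datum1 r) (datum2 r))\<^sup>2 \<partial>lborel)
     \<le> ennreal (119 * (1 + t)) * (moment_norm 2 initial1 + moment_norm 2 initial2)
         * (wasserstein 2 (fst initial1) (fst initial2) + velocity_dist 2 initial1 initial2)"
proof -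
  let ?D = "\<lambda>r. flows.ip (flows.vgap r) (flows.vgap r)"
  have norms: "0 \<le> norm1" "0 \<le> norm2"
    using less_imp_le[OF S1.mass_pos] less_imp_le[OF S2.mass_pos]
    by (auto intro!: sum_nonneg mult_nonneg_nonneg)
  have "(velocity_dist 2 (datum1 r) (datum2 r))\<^sup>2 = ennreal (?D r)" if "r \<in> {0..t}" for r
  proof -
    have "velocity_dist 2 (datum1 r) (datum2 r) = ennreal (sqrt (?D r))"
      using that by (simp add: velocity_dist_evolution lp_norm_2 flows.vgap_def[abs_def])
    then show ?thesis
      using flows.ip_nonneg[of "flows.vgap r"] by (simp add: ennreal_power)
  qed
  then have "(\<integral>\<^sup>+ r\<in>{0..t}. (velocity_dist 2 (datum1 r) (datum2 r))\<^sup>2 \<partial>lborel)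
      = (\<integral>\<^sup>+ r\<in>{0..t}. ennreal (?D r) \<partial>lborel)"
    by (intro nn_integral_cong) (auto simp: indicator_def)
  also have "\<dots> = ennreal (integral {0..t} ?D)"
    by (rule nn_integral_has_integral_lebesgue'[OF flows.ip_nonneg integrable_integral[OF flows.vgap_integrable]]) simp
  also have "\<dots> \<le> ennreal (119 * (1 + t) * (norm1 + norm2) * (W0 + U0))"
    by (rule ennreal_leI[OF velocity_stability[OF t]])
  also have "\<dots> = ennreal (119 * (1 + t)) * (ennreal norm1 + ennreal norm2) * (ennreal W0 + ennreal U0)"
    using t norms by (simp add: ennreal_mult ennreal_plus[symmetric] lp_norm_nonneg del: ennreal_plus)
  finally show ?thesis
    by (simp add: S1.moment_norm_initial S2.moment_norm_initial wasserstein_initial velocity_dist_initial)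
qed

end

theorem theorem2p2:
  shows "\<exists>C>0. \<forall>\<mu>01\<in>discrete_data. \<forall>\<mu>02\<in>discrete_data. \<forall>\<mu>1 \<mu>2.
    sticky_evolution \<mu>01 \<mu>1 \<longrightarrow> sticky_evolution \<mu>02 \<mu>2 \<longrightarrow>
    (\<forall>\<psi> :: real \<Rightarrow> ennreal. \<forall>p :: real. \<forall>t :: real.
       convex_enn \<psi> \<longrightarrow> (\<forall>z. \<psi> (- z) = \<psi> z) \<longrightarrow> lower_semicontinuous \<psi> \<longrightarrow> 1 \<le> p \<longrightarrow> 0 \<le> t \<longrightarrow>
       transport_cost \<psi> (fst (\<mu>1 t)) (fst (\<mu>2 t))
         \<le> (\<integral>\<^sup>+ (x, y). \<psi> (x + t * velocity \<mu>01 x - (y + t * velocity \<mu>02 y))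
               \<partial>optimal_coupling (fst \<mu>01) (fst \<mu>02))
       \<and> wasserstein p (fst (\<mu>1 t)) (fst (\<mu>2 t))
         \<le> wasserstein p (fst \<mu>01) (fst \<mu>02) + ennreal t * velocity_dist p \<mu>01 \<mu>02
       \<and> (\<integral>\<^sup>+ r\<in>{0..t}. (velocity_dist 2 (\<mu>1 r) (\<mu>2 r))\<^sup>2 \<partial>lborel)
         \<le> ennreal (C * (1 + t)) * (moment_norm 2 \<mu>01 + moment_norm 2 \<mu>02)
             * (wasserstein 2 (fst \<mu>01) (fst \<mu>02) + velocity_dist 2 \<mu>01 \<mu>02))"
proof (intro exI[of _ 119] conjI ballI allI impI)
  show "(0::real) < 119" by simp
  fix \<mu>01 \<mu>02 \<mu>1 \<mu>2 and \<psi> :: "real \<Rightarrow> ennreal" and p t :: real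
  assume ev: "sticky_evolution \<mu>01 \<mu>1" "sticky_evolution \<mu>02 \<mu>2"
    and \<psi>: "convex_enn \<psi>" "\<forall>z. \<psi> (- z) = \<psi> z" "lower_semicontinuous \<psi>" and p: "1 \<le> p" and t: "0 \<le> t"
  obtain N1 m1 x1 v1 X1 V1 where 1: "sticky_particles N1 m1 x1 v1 X1 V1" "\<mu>01 = discrete_datum N1 m1 x1 v1"
    "\<And>t. 0 \<le> t \<Longrightarrow> \<mu>1 t = discrete_datum N1 m1 (\<lambda>i. X1 i t) (\<lambda>i. V1 i t)"
    using ev(1) unfolding sticky_evolution_def by blast
  obtain N2 m2 x2 v2 X2 V2 where 2: "sticky_particles N2 m2 x2 v2 X2 V2" "\<mu>02 = discrete_datum N2 m2 x2 v2"
    "\<And>t. 0 \<le> t \<Longrightarrow> \<mu>2 t = discrete_datum N2 m2 (\<lambda>i. X2 i t) (\<lambda>i. V2 i t)"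
    using ev(2) unfolding sticky_evolution_def by blast
  interpret two_systems N1 m1 x1 v1 X1 V1 N2 m2 x2 v2 X2 V2
    unfolding two_systems_def using 1(1) 2(1) by blast
  note eqs = 1(2) 2(2) 1(3)[OF t] 2(3)[OF t]
  show "transport_cost \<psi> (fst (\<mu>1 t)) (fst (\<mu>2 t))
         \<le> (\<integral>\<^sup>+ (x, y). \<psi> (x + t * velocity \<mu>01 x - (y + t * velocity \<mu>02 y))
               \<partial>optimal_coupling (fst \<mu>01) (fst \<mu>02))"
    unfolding eqs using \<psi> t by (intro transport_cost_contraction) auto
  show "wasserstein p (fst (\<mu>1 t)) (fst (\<mu>2 t))
         \<le> wasserstein p (fst \<mu>01) (fst \<mu>02) + ennreal t * velocity_dist p \<mu>01 \<mu>02"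
    unfolding eqs by (rule wasserstein_contraction[OF p t])
  have "(\<integral>\<^sup>+ r\<in>{0..t}. (velocity_dist 2 (\<mu>1 r) (\<mu>2 r))\<^sup>2 \<partial>lborel)
      = (\<integral>\<^sup>+ r\<in>{0..t}. (velocity_dist 2 (datum1 r) (datum2 r))\<^sup>2 \<partial>lborel)"
    by (intro nn_integral_cong) (auto simp: indicator_def 1(3) 2(3))
  then show "(\<integral>\<^sup>+ r\<in>{0..t}. (velocity_dist 2 (\<mu>1 r) (\<mu>2 r))\<^sup>2 \<partial>lborel)
         \<le> ennreal (119 * (1 + t)) * (moment_norm 2 \<mu>01 + moment_norm 2 \<mu>02)
             * (wasserstein 2 (fst \<mu>01) (fst \<mu>02) + velocity_dist 2 \<mu>01 \<mu>02)"
    unfolding eqs using velocity_dist_integral_bound[OF t] by simp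
qed

end
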